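(* For all integers $i,j,k,\ell,m,p,q,r,s,t\ge 0$, the following identity holds in $U(\mathbb{M})$: \begin{align*} &(a^i b^j c^k d^\ell e^m)(a^p b^q c^r d^s e^t)=\\ &\sum_{\alpha=0}^{\ell}\sum_{\beta=0}^{i}\sum_{\gamma=0}^{\beta}\sum_{\delta=0}^{\gamma}\sum_{\epsilon=0}^{j-\alpha-\delta}\ \sum_{\zeta=0}^{j-\alpha-\delta-\epsilon}\ \sum_{\eta=0}^{\ell-\alpha-(\gamma-\delta)}\ \sum_{\theta=0}^{\ell-\alpha-(\gamma-\delta)-\eta}\ \sum_{\lambda=0}^{\eta}\\ &(-1)^{\beta+\zeta+\ell-\alpha-\gamma-\eta}\,\frac{\alpha!\,\beta!\,\lambda!}{2^{\alpha+\gamma}\,3^{\,j-\epsilon-\zeta+\ell-\alpha-\eta-\theta}}\times\\ &\binom{\alpha}{\beta-\gamma}\binom{i}{\beta}\binom{j}{\alpha,\delta,\epsilon,\zeta}\binom{j-\alpha-\epsilon-\zeta}{\lambda}\binom{\ell}{\alpha,\gamma-\delta,\eta,\theta}\binom{\eta}{\lambda}\times\\ &\begin{bmatrix}p\\ j-\beta-\epsilon+\ell-\alpha-\eta-\theta\end{bmatrix}\begin{bmatrix}q\\ \ell-\alpha-\eta-\theta\end{bmatrix}\begin{bmatrix}r\\ \theta\end{bmatrix}\begin{bmatrix}s\\ j-\alpha-\epsilon-\zeta-\lambda\end{bmatrix}\times\\ &a^{i+p-j+\epsilon-\ell+\alpha+\eta+\theta}\;b^{\epsilon+q-\ell+\alpha+\eta+\theta}\;c^{\zeta+k+r-\theta}\;d^{\eta+s+\alpha+\epsilon+\zeta-j}\;e^{j-\alpha-\epsilon-\zeta+\ell-\eta+m+t}.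 \end{align*}
   Context: Let $\mathbb{F}$ be a field of characteristic $\ne 2,3$. $\mathbb{M}$ is the 5-dimensional nilpotent (non-Lie) Malcev algebra over $\mathbb{F}$ with basis $a,b,c,d,e$ and anticommutative product determined by $[a,b]=c$, $[c,d]=e$ (so $[b,a]=-c$, $[d,c]=-e$), all other products of basis elements being $0$. The universal nonassociative enveloping algebra is $U(\mathbb{M})=F(\mathbb{M})/R(\mathbb{M})$, where $F(\mathbb{M})$ is the unital free nonassociative $\mathbb{F}$-algebra on $\{a,b,c,d,e\}$ (with $\mathbb{M}$ viewed as the span of the generators) and $R(\mathbb{M})$ is the two-sided ideal generated by $fg-gf-[f,g]$, $(f,x,y)+(x,f,y)$, $(x,f,y)+(x,y,f)$ for all $f,g\in\mathbb{M}$, $x,y\in F(\mathbb{M})$; here $(x,y,z)=(xy)z-x(yz)$. By a theorem of Pérez-Izquierdo and Shestakov, $\mathbb{M}\to U(\mathbb{M})$ is injective and $U(\mathbb{M})$ has as a basis the left-tapped monomials $x_1(x_2(\cdots(x_{n-1}x_n)\cdots))$ with $n\ge 0$, $x_1\le\cdots\le x_n$ in the order $a<b<c<d<e$ (the empty monomial being $1$). Such a basis monomial with $i$ factors $a$, $j$ factors $b$, $k$ factors $c$, $\ell$ factors $d$, $m$ factors $e$ is written without parentheses as $a^ib^jc^kd^\ell e^m$. Notation: $\binom{n}{i_1,\dots,i_k}=\frac{n!}{i_1!\cdots i_k!\,(n-i_1-\cdots-i_k)!}$, interpreted as $0$ if some $i_j<0$ or $\sum_j i_j>n$ (in particular for ordinary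 binomial coefficients); $\begin{bmatrix}n\\0\end{bmatrix}=1$ and $\begin{bmatrix}n\\k\end{bmatrix}=n(n-1)\cdots(n-k+1)$. Sums whose upper limit is smaller than the lower limit are empty. Any term containing a vanishing binomial, multinomial or bracket coefficient is $0$, even if a negative integer appears formally elsewhere in it as an exponent or lower index. *)

theory Defs
  imports Complex_Main "HOL-Library.Poly_Mapping"
begin

section \<open>The Malcev algebra M\<close>

datatype gen = Ga | Gb | Gc | Gd | Ge

text \<open>Vectors of M are given by their coordinates in the basis a, b, c, d, e.\<close>

type_synonym 'f malcev = "gen \<Rightarrow>\<^sub>0 'f"

fun basis_bracket :: "gen \<Rightarrow> gen \<Rightarrow> ('f::field) malcev" where
  "basis_bracket Ga Gb = Poly_Mapping.single Gc 1"
| "basis_bracket Gb Ga = - Poly_Mapping.single Gc 1"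
| "basis_bracket Gc Gd = Poly_Mapping.single Ge 1"
| "basis_bracket Gd Gc = - Poly_Mapping.single Ge 1"
| "basis_bracket _ _ = 0"

definition pm_scale :: "'f \<Rightarrow> ('x \<Rightarrow>\<^sub>0 'f) \<Rightarrow> ('x \<Rightarrow>\<^sub>0 ('f::field))" where
  "pm_scale c x = Poly_Mapping.map (\<lambda>v. c * v) x"

definition bracket :: "'f malcev \<Rightarrow> 'f malcev \<Rightarrow> ('f::field) malcev" where
  "bracket f g = (\<Sum>x\<in>Poly_Mapping.keys f. \<Sum>y\<in>Poly_Mapping.keys g.
     pm_scale (Poly_Mapping.lookup f x * Poly_Mapping.lookup g y) (basis_bracket x y))"


section \<open>The unital free nonassociative algebra F(M)\<close>

datatype 'x magma = Leaf 'x | Node "'x magma" "'x magma"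

text \<open>Nonassociative words; \<^term>\<open>None\<close> is the empty word.\<close>

fun word_mult :: "'x magma option \<Rightarrow> 'x magma option \<Rightarrow> 'x magma option" where
  "word_mult None v = v"
| "word_mult (Some s) None = Some s"
| "word_mult (Some s) (Some t) = Some (Node s t)"

type_synonym 'f free_alg = "gen magma option \<Rightarrow>\<^sub>0 'f"

text \<open>The library product on \<^typ>\<open>'x \<Rightarrow>\<^sub>0 'f\<close> requires an associative monoid
  of exponents, hence a separate product here.\<close>

definition free_mult :: "'f free_alg \<Rightarrow> 'f free_alg \<Rightarrow> ('f::field) free_alg" where
  "free_mult x y = (\<Sum>u\<in>Poly_Mapping.keys x. \<Sum>v\<in>Poly_Mapping.keys y.
     Poly_Mapping.single (word_mult u v) (Poly_Mapping.lookup x u * Poly_Mapping.lookup y v))"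

definition free_one :: "('f::field) free_alg" where
  "free_one = Poly_Mapping.single None 1"

definition free_assoc :: "'f free_alg \<Rightarrow> 'f free_alg \<Rightarrow> 'f free_alg \<Rightarrow> ('f::field) free_alg" where
  "free_assoc x y z = free_mult (free_mult x y) z - free_mult x (free_mult y z)"

definition free_emb :: "'f malcev \<Rightarrow> ('f::field) free_alg" where
  "free_emb f = (\<Sum>g\<in>Poly_Mapping.keys f. Poly_Mapping.single (Some (Leaf g)) (Poly_Mapping.lookup f g))"


section \<open>The ideal R(M)\<close>

inductive_set R_ideal :: "('f::field) free_alg set" where
  comm: "free_mult (free_emb f) (free_emb g) - free_mult (free_emb g) (free_emb f)
           - free_emb (bracket f g) \<in> R_ideal"
| alt1: "free_assoc (free_emb f) x y + free_assoc x (free_emb f) y \<in> R_ideal"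
| alt2: "free_assoc x (free_emb f) y + free_assoc x y (free_emb f) \<in> R_ideal"
| zero: "0 \<in> R_ideal"
| add: "u \<in> R_ideal \<Longrightarrow> v \<in> R_ideal \<Longrightarrow> u + v \<in> R_ideal"
| scale: "u \<in> R_ideal \<Longrightarrow> pm_scale c u \<in> R_ideal"
| left: "u \<in> R_ideal \<Longrightarrow> free_mult x u \<in> R_ideal"
| right: "u \<in> R_ideal \<Longrightarrow> free_mult u x \<in> R_ideal"

lemma lookup_pm_scale [simp]:
  "Poly_Mapping.lookup (pm_scale c x) k = c * Poly_Mapping.lookup x k"
  by (simp add: pm_scale_def map.rep_eq when_def)

lemma R_ideal_uminus: "u \<in> R_ideal \<Longrightarrow> - u \<in> R_ideal"
proof -
  assume "u \<in> R_ideal"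
  then have "pm_scale (- 1) u \<in> R_ideal" by (rule R_ideal.scale)
  moreover have "pm_scale (- 1) u = - u" by (rule poly_mapping_eqI) simp
  ultimately show ?thesis by simp
qed

lemma R_ideal_diff: "u \<in> R_ideal \<Longrightarrow> v \<in> R_ideal \<Longrightarrow> u - v \<in> R_ideal"
  using R_ideal.add[of u "- v"] R_ideal_uminus[of v] by simp

lemma free_mult_superset:
  assumes "finite S" "finite T" "Poly_Mapping.keys x \<subseteq> S" "Poly_Mapping.keys y \<subseteq> T"
  shows "free_mult x y = (\<Sum>u\<in>S. \<Sum>v\<in>T.
     Poly_Mapping.single (word_mult u v) (Poly_Mapping.lookup x u * Poly_Mapping.lookup y v))"
proof -
  have "free_mult x y = (\<Sum>u\<in>Poly_Mapping.keys x. \<Sum>v\<in>T.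
     Poly_Mapping.single (word_mult u v) (Poly_Mapping.lookup x u * Poly_Mapping.lookup y v))"
    unfolding free_mult_def
    by (rule sum.cong[OF refl], rule sum.mono_neutral_left)
       (use assms in \<open>auto simp: in_keys_iff\<close>)
  also have "\<dots> = (\<Sum>u\<in>S. \<Sum>v\<in>T.
     Poly_Mapping.single (word_mult u v) (Poly_Mapping.lookup x u * Poly_Mapping.lookup y v))"
    by (rule sum.mono_neutral_left) (use assms in \<open>auto simp: in_keys_iff\<close>)
  finally show ?thesis .
qed

lemma free_mult_add_left: "free_mult (x + x') y = free_mult x y + free_mult x' y"
proof -
  let ?S = "Poly_Mapping.keys x \<union> Poly_Mapping.keys x'" and ?T = "Poly_Mapping.keys y"
  note sup = free_mult_superset[of ?S ?T _ y]
  show ?thesis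
    using keys_add[of x x']
    by (simp add: sup lookup_add distrib_right single_add sum.distrib)
qed

lemma free_mult_add_right: "free_mult x (y + y') = free_mult x y + free_mult x y'"
proof -
  let ?S = "Poly_Mapping.keys x" and ?T = "Poly_Mapping.keys y \<union> Poly_Mapping.keys y'"
  note sup = free_mult_superset[of ?S ?T x]
  show ?thesis
    using keys_add[of y y']
    by (simp add: sup lookup_add distrib_left single_add sum.distrib)
qed

lemma free_mult_diff_left: "free_mult (x - x') y = free_mult x y - free_mult x' y"
  using free_mult_add_left[of "x - x'" x' y] by (simp add: algebra_simps)

lemma free_mult_diff_right: "free_mult x (y - y') = free_mult x y - free_mult x y'"
  using free_mult_add_right[of x "y - y'" y'] by (simp add: algebra_simps)

lemma pm_scale_diff: "pm_scale c (x - y) = pm_scale c x - pm_scale c y"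
  by (rule poly_mapping_eqI) (simp add: lookup_minus algebra_simps)

lemma free_mult_scale_left: "free_mult (pm_scale c x) y = pm_scale c (free_mult x y)"
proof -
  have single: "Poly_Mapping.single k (c * v) = pm_scale c (Poly_Mapping.single k v)"
    for k :: "gen magma option" and v
    by (rule poly_mapping_eqI) (simp add: lookup_single when_def)
  have sum: "pm_scale c (sum h A) = (\<Sum>a\<in>A. pm_scale c (h a))"
    for h :: "gen magma option \<Rightarrow> _ free_alg" and A
    by (rule poly_mapping_eqI) (simp add: lookup_sum sum_distrib_left)
  have "Poly_Mapping.keys (pm_scale c x) \<subseteq> Poly_Mapping.keys x"
    by (auto simp: in_keys_iff)
  then have "free_mult (pm_scale c x) y = (\<Sum>u\<in>Poly_Mapping.keys x. \<Sum>v\<in>Poly_Mapping.keys y.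
     Poly_Mapping.single (word_mult u v) (Poly_Mapping.lookup (pm_scale c x) u * Poly_Mapping.lookup y v))"
    by (intro free_mult_superset) auto
  then show ?thesis
    by (simp add: free_mult_def mult.assoc single sum)
qed

lemma free_mult_scale_right: "free_mult x (pm_scale c y) = pm_scale c (free_mult x y)"
proof -
  have single: "Poly_Mapping.single k (a * (c * v)) = pm_scale c (Poly_Mapping.single k (a * v))"
    for k :: "gen magma option" and a v
    by (rule poly_mapping_eqI) (simp add: lookup_single when_def)
  have sum: "pm_scale c (sum h A) = (\<Sum>a\<in>A. pm_scale c (h a))"
    for h :: "gen magma option \<Rightarrow> _ free_alg" and A
    by (rule poly_mapping_eqI) (simp add: lookup_sum sum_distrib_left)
  have "Poly_Mapping.keys (pm_scale c y) \<subseteq> Poly_Mapping.keys y"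
    by (auto simp: in_keys_iff)
  then have "free_mult x (pm_scale c y) = (\<Sum>u\<in>Poly_Mapping.keys x. \<Sum>v\<in>Poly_Mapping.keys y.
     Poly_Mapping.single (word_mult u v) (Poly_Mapping.lookup x u * Poly_Mapping.lookup (pm_scale c y) v))"
    by (intro free_mult_superset) auto
  then show ?thesis
    by (simp add: free_mult_def single sum)
qed

lemma free_mult_one_left: "free_mult free_one x = x"
proof -
  have "free_mult free_one x = (\<Sum>v\<in>Poly_Mapping.keys x. Poly_Mapping.single v (Poly_Mapping.lookup x v))"
    by (simp add: free_mult_def free_one_def)
  also have "\<dots> = x"
    by (rule poly_mapping_eqI) (auto simp: lookup_sum lookup_single when_def in_keys_iff)
  finally show ?thesis .
qed

lemma word_mult_None_right [simp]: "word_mult u None = u"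
  by (cases u) auto

lemma free_mult_one_right: "free_mult x free_one = x"
proof -
  have "free_mult x free_one = (\<Sum>v\<in>Poly_Mapping.keys x. Poly_Mapping.single v (Poly_Mapping.lookup x v))"
    by (simp add: free_mult_def free_one_def)
  also have "\<dots> = x"
    by (rule poly_mapping_eqI) (auto simp: lookup_sum lookup_single when_def in_keys_iff)
  finally show ?thesis .
qed


section \<open>The universal enveloping algebra U(M) = F(M)/R(M)\<close>

definition R_rel :: "'f free_alg \<Rightarrow> ('f::field) free_alg \<Rightarrow> bool" where
  "R_rel x y \<longleftrightarrow> x - y \<in> R_ideal"

lemma equivp_R_rel: "equivp (R_rel :: ('a::field) free_alg \<Rightarrow> _)"
proof (rule equivpI)
  show "reflp (R_rel :: 'a free_alg \<Rightarrow> _)"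
    by (auto simp: reflp_def R_rel_def intro: R_ideal.zero)
  show "symp (R_rel :: 'a free_alg \<Rightarrow> _)"
    by (metis R_ideal_uminus R_rel_def minus_diff_eq sympI)
  show "transp (R_rel :: 'a free_alg \<Rightarrow> _)"
  proof (rule transpI)
    fix x y z :: "'a free_alg"
    assume "R_rel x y" "R_rel y z"
    then have "(x - y) + (y - z) \<in> R_ideal"
      unfolding R_rel_def by (rule R_ideal.add)
    then show "R_rel x z" by (simp add: R_rel_def)
  qed
qed

quotient_type (overloaded) 'f UM = "('f::field) free_alg" / R_rel
  by (rule equivp_R_rel)

instantiation UM :: (field) ab_group_add
begin

lift_definition zero_UM :: "'f::field UM" is "0" .

lift_definition plus_UM :: "'f::field UM \<Rightarrow> 'f UM \<Rightarrow> 'f UM" is "(+)"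
  unfolding R_rel_def by (metis R_ideal.add add_diff_add)

lift_definition uminus_UM :: "'f::field UM \<Rightarrow> 'f UM" is "uminus"
  unfolding R_rel_def by (metis R_ideal_uminus minus_diff_minus)

lift_definition minus_UM :: "'f::field UM \<Rightarrow> 'f UM \<Rightarrow> 'f UM" is "(-)"
proof -
  fix x x' y y' :: "'f free_alg"
  assume "R_rel x x'" "R_rel y y'"
  then have "(x - x') - (y - y') \<in> R_ideal"
    unfolding R_rel_def by (rule R_ideal_diff)
  then show "R_rel (x - y) (x' - y')"
    by (simp add: R_rel_def algebra_simps)
qed

instance
  by standard (transfer; simp add: R_rel_def R_ideal.zero algebra_simps)+

end

instantiation UM :: (field) "{one, times}"
begin

lift_definition one_UM :: "'f::field UM" is free_one .

lift_definition times_UM :: "'f::field UM \<Rightarrow> 'f UM \<Rightarrow> 'f UM" is free_mult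
proof -
  fix x x' y y' :: "'f free_alg"
  assume "R_rel x x'" "R_rel y y'"
  then have "free_mult (x - x') y + free_mult x' (y - y') \<in> R_ideal"
    unfolding R_rel_def by (intro R_ideal.add R_ideal.left R_ideal.right)
  then show "R_rel (free_mult x y) (free_mult x' y')"
    by (simp add: R_rel_def free_mult_diff_left free_mult_diff_right)
qed

instance ..

end

lift_definition scale_UM :: "'f::field \<Rightarrow> 'f UM \<Rightarrow> 'f UM" (infixr \<open>*\<^sub>U\<close> 75) is pm_scale
  unfolding R_rel_def by (metis R_ideal.scale pm_scale_diff)

interpretation UM: vector_space "scale_UM :: 'f::field \<Rightarrow> 'f UM \<Rightarrow> 'f UM"
proof
  have eq: "R_rel x y" if "x = y" for x y :: "'f free_alg"
    using that by (simp add: R_rel_def R_ideal.zero)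
  fix a b :: 'f and x y :: "'f UM"
  show "a *\<^sub>U (x + y) = a *\<^sub>U x + a *\<^sub>U y"
    by (transfer, rule eq, rule poly_mapping_eqI) (simp add: lookup_add algebra_simps)
  show "(a + b) *\<^sub>U x = a *\<^sub>U x + b *\<^sub>U x"
    by (transfer, rule eq, rule poly_mapping_eqI) (simp add: lookup_add algebra_simps)
  show "a *\<^sub>U b *\<^sub>U x = (a * b) *\<^sub>U x"
    by (transfer, rule eq, rule poly_mapping_eqI) (simp add: algebra_simps)
  show "1 *\<^sub>U x = x"
    by (transfer, rule eq, rule poly_mapping_eqI) simp
qed

lemma UM_distrib_left: "(x :: 'f::field UM) * (y + z) = x * y + x * z"
  by transfer (simp add: R_rel_def R_ideal.zero free_mult_add_right)

lemma UM_distrib_right: "((x :: 'f::field UM) + y) * z = x * z + y * z"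
  by transfer (simp add: R_rel_def R_ideal.zero free_mult_add_left)

lemma UM_scale_left: "(c *\<^sub>U x) * y = c *\<^sub>U (x * y)"
  by transfer (simp add: R_rel_def R_ideal.zero free_mult_scale_left)

lemma UM_scale_right: "x * (c *\<^sub>U y) = c *\<^sub>U (x * y)"
  by transfer (simp add: R_rel_def R_ideal.zero free_mult_scale_right)

lemma UM_one_left: "1 * (x :: 'f::field UM) = x"
  by transfer (simp add: R_rel_def R_ideal.zero free_mult_one_left)

lemma UM_one_right: "(x :: 'f::field UM) * 1 = x"
  by transfer (simp add: R_rel_def R_ideal.zero free_mult_one_right)

lift_definition UM_emb :: "'f::field malcev \<Rightarrow> 'f UM" is free_emb .

fun left_tapped :: "'f::field UM list \<Rightarrow> 'f UM" where
  "left_tapped [] = 1"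
| "left_tapped [x] = x"
| "left_tapped (x # y # ys) = x * left_tapped (y # ys)"

text \<open>The left-tapped monomial \<open>a\<^sup>i b\<^sup>j c\<^sup>k d\<^sup>l e\<^sup>m\<close>.
  Exponents are integers because differences of indices occur as exponents; a negative
  exponent (which only ever appears with a vanishing coefficient) is read as 0.\<close>

definition UM_monom :: "int \<Rightarrow> int \<Rightarrow> int \<Rightarrow> int \<Rightarrow> int \<Rightarrow> 'f::field UM" where
  "UM_monom i j k l m = left_tapped (map (\<lambda>g. UM_emb (Poly_Mapping.single g 1))
     (replicate (nat i) Ga @ replicate (nat j) Gb @ replicate (nat k) Gc @
      replicate (nat l) Gd @ replicate (nat m) Ge))"


section \<open>Coefficients\<close>

text \<open>\<open>multinom n [i\<^sub>1, \<dots>, i\<^sub>k] = n! / (i\<^sub>1! \<cdots> i\<^sub>k! (n - i\<^sub>1 - \<dots> - i\<^sub>k)!)\<close>, with the complementary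
  part left implicit, so \<open>multinom n [i]\<close> is the ordinary binomial coefficient.\<close>

definition multinom :: "int \<Rightarrow> int list \<Rightarrow> nat" where
  "multinom n ks =
     (if (\<exists>k\<in>set ks. k < 0) \<or> sum_list ks > n then 0
      else fact (nat n) div (prod_list (map (\<lambda>k. fact (nat k)) ks) * fact (nat (n - sum_list ks))))"

text \<open>The falling factorial \<open>n (n - 1) \<cdots> (n - k + 1)\<close>.\<close>

definition falling :: "int \<Rightarrow> int \<Rightarrow> int" where
  "falling n k = (\<Prod>h\<in>{0..<k}. n - h)"

end

theory Submission
  imports Defs "HOL-Library.Function_Algebras"
begin

text \<open>
  Write \<open>[x, f] = x f - f x\<close> for the adjoint action of \<open>f\<close> in M on U(M). The defining relations give
  \<open>[y x, f] = [y, f] x + y [x, f] + 3 (f, y, x)\<close> and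
  \<open>6 (f, g, x) = [[x, f], g] - [[x, g], f] - [x, [f, g]]\<close>, so left multiplications and adjoint
  actions of the generators on left-tapped monomials are computed by induction; they are those of
  the differential operators
  \<open>L\<^sub>b = b - c \<partial>\<^sub>a + (e/3) \<partial>\<^sub>a \<partial>\<^sub>d\<close>, \<open>L\<^sub>d = d - e \<partial>\<^sub>c - (e/3) \<partial>\<^sub>a \<partial>\<^sub>b\<close>,
  \<open>ad\<^sub>a = - (c - (e/2) \<partial>\<^sub>d) \<partial>\<^sub>b\<close>, \<open>ad\<^sub>b = (c - (e/2) \<partial>\<^sub>d) \<partial>\<^sub>a\<close>,
  \<open>ad\<^sub>c = - e \<partial>\<^sub>d\<close>, \<open>ad\<^sub>d = e \<partial>\<^sub>c + (e/2) \<partial>\<^sub>a \<partial>\<^sub>b\<close>.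
  Feeding this back into the first identity shows that left multiplication by the generating
  function of the monomials \<open>a\<^sup>i b\<^sup>j d\<^sup>l\<close>, with formal variables \<open>x, y, u\<close>, is
  \<open>exp (x a) exp (y L\<^sub>b) exp (y u (e/6) (\<partial>\<^sub>a - x)) exp (x (e/6) (y \<partial>\<^sub>d - u \<partial>\<^sub>b)) exp (u L\<^sub>d)\<close>,
  and the stated sum is the normal ordering of this product. As the characteristic may be positive,
  exponentials are replaced by the binomial theorem for commuting operators.
\<close>

section \<open>Associators and commutators with generators\<close>

definition ad :: "'f::field UM \<Rightarrow> 'f UM \<Rightarrow> 'f UM" where
  "ad f x = x * f - f * x"

definition assoc :: "'f::field UM \<Rightarrow> 'f UM \<Rightarrow> 'f UM \<Rightarrow> 'f UM" where
  "assoc x y z = (x * y) * z - x * (y * z)"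

definition gn :: "gen \<Rightarrow> 'f::field UM" where
  "gn g = UM_emb (Poly_Mapping.single g 1)"

lemma UM_mult_zero_left [simp]: "(0 :: 'f::field UM) * x = 0"
  using UM_distrib_right[of 0 0 x] by simp

lemma UM_mult_zero_right [simp]: "(x :: 'f::field UM) * 0 = 0"
  using UM_distrib_left[of x 0 0] by simp

lemma UM_mult_minus_left [simp]: "- (x :: 'f::field UM) * y = - (x * y)"
  using UM_distrib_right[of x "- x" y] by (simp add: add_eq_0_iff2)

lemma UM_mult_minus_right [simp]: "(x :: 'f::field UM) * - y = - (x * y)"
  using UM_distrib_left[of x y "- y"] by (simp add: add_eq_0_iff2)

lemma UM_diff_left: "((x :: 'f::field UM) - y) * z = x * z - y * z"
  using UM_distrib_right[of x "- y" z] by simp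

lemma UM_diff_right: "(x :: 'f::field UM) * (y - z) = x * y - x * z"
  using UM_distrib_left[of x y "- z"] by simp

lemmas UM_algebra = UM_distrib_left UM_distrib_right UM_diff_left UM_diff_right
  UM_scale_left UM_scale_right

lemma R_rel_0_iff: "R_rel x 0 \<longleftrightarrow> x \<in> R_ideal"
  by (simp add: R_rel_def)

lemma assoc_emb_left: "assoc (UM_emb f) x y + assoc x (UM_emb f) y = 0"
  unfolding assoc_def
proof (transfer, goal_cases)
  case (1 f x y)
  then show ?case
    using R_ideal.alt1[of f x y] by (simp add: free_assoc_def R_rel_0_iff)
qed

lemma assoc_emb_right: "assoc x (UM_emb f) y + assoc x y (UM_emb f) = 0"
  unfolding assoc_def
proof (transfer, goal_cases)
  case (1 x f y)
  then show ?case
    using R_ideal.alt2[of x f y] by (simp add: free_assoc_def R_rel_0_iff)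
qed

lemma comm_emb: "UM_emb f * UM_emb g - UM_emb g * UM_emb f = UM_emb (bracket f g)"
proof (transfer, goal_cases)
  case (1 f g)
  then show ?case
    using R_ideal.comm[of f g] by (simp add: R_rel_def)
qed

lemma UM_emb_0 [simp]: "UM_emb 0 = 0"
  by transfer (simp add: free_emb_def R_rel_def R_ideal.zero)

lemma bracket_single: "bracket (Poly_Mapping.single x 1) (Poly_Mapping.single y 1) = (basis_bracket x y :: 'f::field malcev)"
  unfolding bracket_def by (simp, rule poly_mapping_eqI, simp)

lemma assoc_gn_left: "assoc x (gn f) y = - assoc (gn f) x y"
  using assoc_emb_left[of "Poly_Mapping.single f 1" x y] by (simp add: gn_def eq_neg_iff_add_eq_0 add.commute)

text \<open>By the two alternative relations a generator changes its place in an associator at the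
  cost of a sign, so moving it across two places costs nothing.\<close>

lemma assoc_gn_right: "assoc x y (gn f) = assoc (gn f) x y"
  using assoc_emb_right[of x "Poly_Mapping.single f 1" y] assoc_gn_left[of x f y]
  by (simp add: gn_def)

lemma comm_gn:
  "ad (gn g) (gn f) = UM_emb (basis_bracket f g)"
  unfolding ad_def gn_def comm_emb bracket_single ..

lemma ad_gn_self [simp]: "ad (gn f) (gn f) = 0"
  by (simp add: ad_def)

lemma ad_swap: "ad x y = - ad y x"
  by (simp add: ad_def)

lemma ad_add [simp]: "ad f (x + y) = ad f x + ad f y"
  and ad_diff [simp]: "ad f (x - y) = ad f x - ad f y"
  and ad_minus [simp]: "ad f (- x) = - ad f x"
  and ad_zero [simp]: "ad f 0 = 0"
  and ad_scale [simp]: "ad f (c *\<^sub>U x) = c *\<^sub>U ad f x"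
  by (simp_all add: ad_def UM_algebra UM.scale_right_diff_distrib)

text \<open>The failure of the product rule is an alternating sum of three associators containing
  \<open>gn f\<close>, all equal to \<open>assoc (gn f) y x\<close> up to sign; hence the factor
  3.\<close>

lemma ad_mult:
  "ad (gn f) (y * x) = ad (gn f) y * x + y * ad (gn f) x + 3 *\<^sub>U assoc (gn f) y x"
proof -
  have three: "3 *\<^sub>U z = z + z + z" for z :: "'a UM"
    using UM.scale_left_distrib[of 1 2 z] UM.scale_left_distrib[of 1 1 z]
    by (simp add: add.assoc)
  have "ad (gn f) (y * x) - ad (gn f) y * x - y * ad (gn f) x
      = assoc y x (gn f) + assoc (gn f) y x - assoc y (gn f) x"
    by (simp add: ad_def assoc_def UM_algebra)
  then show ?thesis
    unfolding three by (simp add: assoc_gn_right assoc_gn_left algebra_simps)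
qed

lemma left_tapped_Cons: "left_tapped (x # xs) = x * left_tapped xs"
  by (cases xs) (simp_all add: UM_one_right)

definition mon :: "nat \<Rightarrow> nat \<Rightarrow> nat \<Rightarrow> nat \<Rightarrow> nat \<Rightarrow> 'f::field UM" where
  "mon i j k l m = UM_monom (int i) (int j) (int k) (int l) (int m)"

text \<open>Prepending a letter yields a monomial by definition only if no smaller letter occurs;
  all other products need the relations.\<close>

lemma mon_Ga: "gn Ga * mon i j k l m = mon (Suc i) j k l m"
  and mon_Gb: "gn Gb * mon 0 j k l m = mon 0 (Suc j) k l m"
  and mon_Gc: "gn Gc * mon 0 0 k l m = mon 0 0 (Suc k) l m"
  and mon_Gd: "gn Gd * mon 0 0 0 l m = mon 0 0 0 (Suc l) m"
  and mon_Ge: "gn Ge * mon 0 0 0 0 m = mon 0 0 0 0 (Suc m)"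
  and mon_0: "mon 0 0 0 0 0 = 1"
  by (simp_all add: mon_def UM_monom_def left_tapped_Cons gn_def nat_add_distrib del: of_nat_Suc
      flip: replicate_Suc) (simp_all add: left_tapped_Cons)

lemma ad_gens:
  "ad (gn Gb) (gn Ga) = (gn Gc :: 'f::field UM)"
  "ad (gn Gd) (gn Gc) = (gn Ge :: 'f::field UM)"
  "ad (gn Gc) (gn Ga) = (0 :: 'f::field UM)"
  "ad (gn Gd) (gn Ga) = (0 :: 'f::field UM)"
  "ad (gn Ge) (gn Ga) = (0 :: 'f::field UM)"
  "ad (gn Gc) (gn Gb) = (0 :: 'f::field UM)"
  "ad (gn Gd) (gn Gb) = (0 :: 'f::field UM)"
  "ad (gn Ge) (gn Gb) = (0 :: 'f::field UM)"
  "ad (gn Ge) (gn Gc) = (0 :: 'f::field UM)"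
  "ad (gn Ge) (gn Gd) = (0 :: 'f::field UM)"
  by (simp_all add: comm_gn) (simp_all add: gn_def)

lemma ad_gens':
  "ad (gn Ga) (gn Gb) = - (gn Gc :: 'f::field UM)"
  "ad (gn Gc) (gn Gd) = - (gn Ge :: 'f::field UM)"
  "ad (gn Ga) (gn Gc) = (0 :: 'f::field UM)"
  "ad (gn Ga) (gn Gd) = (0 :: 'f::field UM)"
  "ad (gn Ga) (gn Ge) = (0 :: 'f::field UM)"
  "ad (gn Gb) (gn Gc) = (0 :: 'f::field UM)"
  "ad (gn Gb) (gn Gd) = (0 :: 'f::field UM)"
  "ad (gn Gb) (gn Ge) = (0 :: 'f::field UM)"
  "ad (gn Gc) (gn Ge) = (0 :: 'f::field UM)"
  "ad (gn Gd) (gn Ge) = (0 :: 'f::field UM)"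
  using ad_gens[where 'f='f] by (metis ad_swap neg_0_equal_iff_equal)+

lemma ad_1 [simp]: "ad f 1 = 0"
  by (simp add: ad_def UM_one_left UM_one_right)

lemma ad_arg0 [simp]: "ad 0 x = 0"
  and ad_arg_minus [simp]: "ad (- f) x = - ad f x"
  by (simp_all add: ad_def)

lemma assoc_gn_commute: "assoc (gn f) (gn g) x = - assoc (gn g) (gn f) x"
  by (metis assoc_gn_left assoc_gn_right)

text \<open>The characteristic enters only through an inverse \<open>h\<close> of 6; below,
  \<open>h2\<close> is 1/3 and \<open>h3\<close> is 1/2.\<close>

locale inv6 =
  fixes h :: "'f::field"
  assumes h6: "6 * h = 1"
begin

text \<open>Kept folded in the computations on monomials, which are identities between integral
  combinations in which \<open>h2\<close> and \<open>h3\<close> are formal scalars.\<close>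

definition h2 where "h2 = 2 * h"
definition h3 where "h3 = 3 * h"

abbreviation a :: "'f UM" where "a \<equiv> gn Ga"
abbreviation b :: "'f UM" where "b \<equiv> gn Gb"
abbreviation c :: "'f UM" where "c \<equiv> gn Gc"
abbreviation d :: "'f UM" where "d \<equiv> gn Gd"
abbreviation e :: "'f UM" where "e \<equiv> gn Ge"
abbreviation M :: "nat \<Rightarrow> nat \<Rightarrow> nat \<Rightarrow> nat \<Rightarrow> nat \<Rightarrow> 'f UM" where "M \<equiv> mon"

text \<open>Apply \<open>ad_mult\<close> to \<open>x * gn g\<close> and to \<open>gn g * x\<close>.
  Both give three times the same associator, the first after a sign change, and in their sum only
  adjoint actions survive.\<close>

lemma assoc_gens:
  fixes x :: "'f UM"
  shows "assoc (gn f) (gn g) x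
    = h *\<^sub>U (ad (gn g) (ad (gn f) x) - ad (gn f) (ad (gn g) x) - ad (ad (gn g) (gn f)) x)"
    (is "?A = h *\<^sub>U ?r")
proof -
  have *: "3 *\<^sub>U assoc (gn f) x (gn g) = - (3 *\<^sub>U ?A)"
    by (subst assoc_gn_right, subst assoc_gn_commute) (simp)
  have 1: "3 *\<^sub>U ?A = ad (gn f) x * gn g + x * ad (gn f) (gn g) - ad (gn f) (x * gn g)"
    unfolding ad_mult * by simp
  have 2: "3 *\<^sub>U ?A = ad (gn f) (gn g * x) - ad (gn f) (gn g) * x - gn g * ad (gn f) x"
    unfolding ad_mult by simp
  have "3 *\<^sub>U ?A + 3 *\<^sub>U ?A = ?r"
    by (subst 1, subst 2) (simp add: ad_def UM_algebra)
  then have "6 *\<^sub>U ?A = ?r"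
    by (simp flip: UM.scale_left_distrib)
  then have "h *\<^sub>U 6 *\<^sub>U ?A = h *\<^sub>U ?r"
    by simp
  then show ?thesis
    using h6 by (simp add: mult.commute)
qed

text \<open>Together with \<open>L_step\<close>, this reduces the actions on \<open>gn f * y\<close>
  to actions on \<open>y\<close>, which drives the inductions over monomials.\<close>

lemma ad_step:
  fixes y :: "'f UM"
  shows "ad (gn g) (gn f * y) = gn f * ad (gn g) y + ad (gn g) (gn f) * y
    - h3 *\<^sub>U (ad (gn g) (ad (gn f) y) - ad (gn f) (ad (gn g) y) - ad (ad (gn g) (gn f)) y)"
  by (subst ad_mult, subst assoc_gn_commute, subst assoc_gens) (simp add: h3_def)

text \<open>The correction is a difference of two associators, which are negatives of each other;
  together they give 2/6 = 1/3, that is \<open>h2\<close>.\<close>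

lemma L_step:
  fixes y :: "'f UM"
  shows "gn g * (gn f * y) = gn f * (gn g * y) - ad (gn g) (gn f) * y
    - h2 *\<^sub>U (ad (gn f) (ad (gn g) y) - ad (gn g) (ad (gn f) y) + ad (ad (gn g) (gn f)) y)"
proof -
  have "gn g * (gn f * y) = gn f * (gn g * y) - ad (gn g) (gn f) * y
      + (assoc (gn f) (gn g) y - assoc (gn g) (gn f) y)"
    by (simp add: assoc_def ad_def UM_algebra)
  also have "assoc (gn f) (gn g) y - assoc (gn g) (gn f) y = - (assoc (gn g) (gn f) y + assoc (gn g) (gn f) y)"
    by (subst assoc_gn_commute) simp
  also have "assoc (gn g) (gn f) y + assoc (gn g) (gn f) y =
     h2 *\<^sub>U (ad (gn f) (ad (gn g) y) - ad (gn g) (ad (gn f) y) + ad (ad (gn g) (gn f)) y)"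
    by (subst (1 2) assoc_gens) (simp add: ad_swap[of "gn f" "gn g"] h2_def flip: UM.scale_left_distrib)
  finally show ?thesis by simp
qed

section \<open>Left multiplications and adjoint actions on monomials\<close>

abbreviation s :: "nat \<Rightarrow> 'f UM \<Rightarrow> 'f UM" where "s n x \<equiv> of_nat n *\<^sub>U x"

lemma s_Suc: "s (Suc n) x = x + s n x"
  by (simp add: UM.scale_left_distrib)

lemmas action_simps = ad_gens ad_gens' mon_Ga mon_Gb mon_Gc mon_Gd mon_Ge UM_algebra s_Suc UM.scale_left_commute
  UM.scale_right_distrib UM.scale_right_diff_distrib

text \<open>All nine actions are proved together since each recursion step involves several of the
  others. They are the operators of the overview; truncated exponents such as \<open>i - 1\<close>
  always carry a factor that vanishes at 0.\<close>

definition mon_action :: "nat \<Rightarrow> nat \<Rightarrow> nat \<Rightarrow> nat \<Rightarrow> nat \<Rightarrow> bool" where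
  "mon_action i j k l m \<longleftrightarrow>
    b * M i j k l m = M i (Suc j) k l m - s i (M (i - 1) j (Suc k) l m)
       + h2 *\<^sub>U s i (s l (M (i - 1) j k (l - 1) (Suc m))) \<and>
    c * M i j k l m = M i j (Suc k) l m \<and>
    d * M i j k l m = M i j k (Suc l) m - s k (M i j (k - 1) l (Suc m))
       - h2 *\<^sub>U s i (s j (M (i - 1) (j - 1) k l (Suc m))) \<and>
    e * M i j k l m = M i j k l (Suc m) \<and>
    ad a (M i j k l m) = h3 *\<^sub>U s j (s l (M i (j - 1) k (l - 1) (Suc m)))
       - s j (M i (j - 1) (Suc k) l m) \<and>
    ad b (M i j k l m) = s i (M (i - 1) j (Suc k) l m)
       - h3 *\<^sub>U s i (s l (M (i - 1) j k (l - 1) (Suc m))) \<and>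
    ad c (M i j k l m) = - s l (M i j k (l - 1) (Suc m)) \<and>
    ad d (M i j k l m) = s k (M i j (k - 1) l (Suc m))
       + h3 *\<^sub>U s i (s j (M (i - 1) (j - 1) k l (Suc m))) \<and>
    ad e (M i j k l m) = 0"

lemma mon_action_e: "mon_action 0 0 0 0 m"
proof (induction m)
  case 0
  show ?case
    by (simp add: mon_action_def mon_Gb mon_Gc mon_Gd mon_Ge) (simp add: mon_0)
next
  case (Suc m)
  then show ?case
    unfolding mon_action_def mon_Ge[symmetric, of m] ad_step[of _ Ge]
    by (simp add: ad_gens ad_gens' mon_Gb mon_Gc mon_Gd mon_Ge)
qed

text \<open>The letters are added in the order \<open>e\<close>, \<open>d\<close>, \<open>c\<close>,
  \<open>b\<close>, \<open>a\<close>, one induction per letter, so that the new letter can be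
  prepended by definition.\<close>

lemma mon_action_d: "mon_action 0 0 0 l m"
proof (induction l arbitrary: m rule: less_induct)
  case (less l)
  show ?case
  proof (cases l)
    case 0
    then show ?thesis by (simp add: mon_action_e)
  next
    case (Suc l')
    have 1: "mon_action 0 0 0 l' m" for m using less Suc by simp
    \<comment> \<open>Iterated adjoint actions may lower the exponent once before acting
      again.\<close>
    have 2: "mon_action 0 0 0 (l' - 1) m" for m using less Suc by simp
    show ?thesis
      using 1 2
      unfolding Suc mon_action_def mon_Gd[symmetric, of l'] ad_step[of _ Gd] L_step[of Ge Gd]
      by (cases l') (simp_all add: action_simps del: of_nat_Suc UM.scale_scale)
  qed
qed

lemma mon_action_c: "mon_action 0 0 k l m"
proof (induction k arbitrary: l m rule: less_induct)
  case (less k)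
  show ?case
  proof (cases k)
    case 0
    then show ?thesis by (simp add: mon_action_d)
  next
    case (Suc k')
    have 1: "mon_action 0 0 k' l m" for l m using less Suc by simp
    have 2: "mon_action 0 0 (k' - 1) l m" for l m using less Suc by simp
    show ?thesis
      using 1 2
      unfolding Suc mon_action_def mon_Gc[symmetric, of k'] ad_step[of _ Gc] L_step[of Gd Gc] L_step[of Ge Gc]
      by (cases k'; cases l) (simp_all add: action_simps del: of_nat_Suc UM.scale_scale)
  qed
qed

lemma mon_action_b: "mon_action 0 j k l m"
proof (induction j arbitrary: k l m rule: less_induct)
  case (less j)
  show ?case
  proof (cases j)
    case 0
    then show ?thesis by (simp add: mon_action_c)
  next
    case (Suc j')
    have 1: "mon_action 0 j' k l m" for k l m using less Suc by simp
    have 2: "mon_action 0 (j' - 1) k l m" for k l m using less Suc by simp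
    show ?thesis
      using 1 2
      unfolding Suc mon_action_def mon_Gb[symmetric, of j'] ad_step[of _ Gb] L_step[of Gc Gb] L_step[of Gd Gb] L_step[of Ge Gb]
      by (cases j'; cases k; cases l) (simp_all add: action_simps del: of_nat_Suc UM.scale_scale)
  qed
qed

lemma mon_action_a: "mon_action i j k l m"
proof (induction i arbitrary: j k l m rule: less_induct)
  case (less i)
  show ?case
  proof (cases i)
    case 0
    then show ?thesis by (simp add: mon_action_b)
  next
    case (Suc i')
    have 1: "mon_action i' j k l m" for j k l m using less Suc by simp
    have 2: "mon_action (i' - 1) j k l m" for j k l m using less Suc by simp
    show ?thesis
      using 1 2
      unfolding Suc mon_action_def mon_Ga[symmetric, of i'] ad_step[of _ Ga] L_step[of Gb Ga] L_step[of Gc Ga] L_step[of Gd Ga] L_step[of Ge Ga]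
      by (cases i'; cases j; cases k; cases l) (simp_all add: action_simps del: of_nat_Suc UM.scale_scale)
  qed
qed

end

section \<open>Monomials span the enveloping algebra\<close>

interpretation UM2: vector_space_pair "scale_UM :: 'f::field \<Rightarrow> _" "scale_UM :: 'f \<Rightarrow> _"
  by unfold_locales

abbreviation linU :: "('f::field UM \<Rightarrow> 'f UM) \<Rightarrow> bool" where
  "linU \<equiv> Vector_Spaces.linear scale_UM scale_UM"

lemma linear_UM_iff:
  "linU f \<longleftrightarrow> (\<forall>x y. f (x + y) = f x + f y) \<and> (\<forall>k x. f (k *\<^sub>U x) = k *\<^sub>U f x)"
  by (simp add: Vector_Spaces.linear_iff UM.vector_space_axioms)

definition mons :: "'f::field UM set" where
  "mons = {mon i j k l m | i j k l m. True}"

lemma linU_span: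
  assumes "linU f" "\<And>i j k l m. f (mon i j k l m) \<in> UM.span mons" "x \<in> UM.span mons"
  shows "f x \<in> UM.span mons"
proof -
  have "f ` mons \<subseteq> UM.span mons"
    using assms(2) by (auto simp: mons_def)
  then have "UM.span (f ` mons) \<subseteq> UM.span mons"
    by (rule UM.span_minimal) (rule UM.subspace_span)
  then show ?thesis
    using UM2.linear_span_image[OF assms(1), of mons] assms(3) by blast
qed

lemma linU_mult_left: "linU (\<lambda>x. y * x)"
  and linU_mult_right: "linU (\<lambda>x. x * y)"
  and linU_ad: "linU (ad y)"
  by (simp_all add: linear_UM_iff UM_algebra)

lemma mon_in_span: "mon i j k l m \<in> UM.span mons"
  by (rule UM.span_base) (unfold mons_def, blast)

context inv6
begin

lemmas actions = mon_action_a[unfolded mon_action_def]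

lemmas in_span_intros = UM.span_add UM.span_diff UM.span_neg UM.span_scale UM.span_zero mon_in_span

lemma gn_mult_span:
  assumes "x \<in> UM.span mons" shows "gn g * (x::'f UM) \<in> UM.span mons"
  using linU_mult_left _ assms
  by (rule linU_span, cases g) (auto simp: actions mon_Ga intro!: in_span_intros)

lemma ad_gn_span:
  assumes "x \<in> UM.span mons" shows "ad (gn g) (x::'f UM) \<in> UM.span mons"
  using linU_ad _ assms
  by (rule linU_span, cases g) (auto simp: actions mon_Ga intro!: in_span_intros)

lemma assoc_gn_ad:
  fixes x :: "'f UM"
  shows "assoc (gn f) y x = h2 *\<^sub>U (ad (gn f) (y * x) - ad (gn f) y * x - y * ad (gn f) x)"
proof -
  have "ad (gn f) (y * x) - ad (gn f) y * x - y * ad (gn f) x = 3 *\<^sub>U assoc (gn f) y x"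
    by (simp add: ad_mult)
  then show ?thesis
    using h6 by (simp add: h2_def mult_ac)
qed

lemma gn_mult_mult:
  fixes x :: "'f UM"
  shows "(gn f * y) * x = gn f * (y * x) + assoc (gn f) y x"
  by (simp add: assoc_def)

text \<open>The associator correcting \<open>(gn f * y) * x\<close> is a third of the failure of the
  product rule for \<open>ad (gn f)\<close>, so only left multiplications by \<open>y\<close> and
  \<open>ad (gn f) y\<close> have to preserve the span.\<close>

lemma span_mult_step:
  fixes x y :: "'f UM"
  assumes "\<And>x. x \<in> UM.span mons \<Longrightarrow> y * x \<in> UM.span mons"
    and "\<And>x. x \<in> UM.span mons \<Longrightarrow> ad (gn f) y * x \<in> UM.span mons"
    and "x \<in> UM.span mons"
  shows "(gn f * y) * x \<in> UM.span mons"
  unfolding gn_mult_mult assoc_gn_ad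
  by (intro UM.span_add UM.span_diff UM.span_scale gn_mult_span ad_gn_span assms)

text \<open>Peel off the first letter. Its adjoint action on the rest is zero or a combination of
  monomials with the same power of that letter, so the induction hypothesis applies.\<close>

lemma mon_mult_span:
  assumes "x \<in> UM.span mons"
  shows "M i j k l m * x \<in> UM.span mons"
proof -
  have e: "M 0 0 0 0 m * x \<in> UM.span mons" if "x \<in> UM.span mons" for m x
    using that
  proof (induction m arbitrary: x)
    case (Suc m)
    then show ?case unfolding mon_Ge[symmetric]
      by (intro span_mult_step) (auto simp: actions UM.span_zero)
  qed (simp add: mon_0 UM_one_left)
  have d: "M 0 0 0 l m * x \<in> UM.span mons" if "x \<in> UM.span mons" for l m x
    using that
  proof (induction l arbitrary: m x)
    case (Suc l)
    then show ?case unfolding mon_Gd[symmetric]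
      by (intro span_mult_step) (auto simp: actions UM.span_zero)
  qed (simp add: e)
  have c: "M 0 0 k l m * x \<in> UM.span mons" if "x \<in> UM.span mons" for k l m x
    using that
  proof (induction k arbitrary: l m x)
    case (Suc k)
    then show ?case unfolding mon_Gc[symmetric]
      by (intro span_mult_step) (auto simp: actions UM_algebra intro!: UM.span_neg UM.span_scale)
  qed (simp add: d)
  have b: "M 0 j k l m * x \<in> UM.span mons" if "x \<in> UM.span mons" for j k l m x
    using that
  proof (induction j arbitrary: k l m x)
    case (Suc j)
    then show ?case unfolding mon_Gb[symmetric]
      by (intro span_mult_step) (auto simp: actions UM.span_zero)
  qed (simp add: c)
  show ?thesis
    using assms
  proof (induction i arbitrary: j k l m x)
    case (Suc i)
    then show ?case unfolding mon_Ga[symmetric]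
    proof (intro span_mult_step)
      fix x :: "'f UM" assume "x \<in> UM.span mons"
      moreover have "M i (j - 1) k' l' m' * x \<in> UM.span mons" if "x \<in> UM.span mons" for k' l' m' x
        using Suc.IH that by blast
      ultimately show "ad a (M i j k l m) * x \<in> UM.span mons"
        by (auto simp: actions UM_algebra intro!: UM.span_diff UM.span_scale)
    qed auto
  qed (simp add: b)
qed

lemma span_mult:
  fixes x y :: "'f UM"
  assumes "y \<in> UM.span mons" "x \<in> UM.span mons"
  shows "y * x \<in> UM.span mons"
  using linU_mult_right[of x] mon_mult_span[OF assms(2)] assms(1) by (rule linU_span)

lemma word_in_span: "abs_UM (Poly_Mapping.single (Some w) (1::'f)) \<in> UM.span mons"
proof (induction w)
  case (Leaf g)
  have "abs_UM (Poly_Mapping.single (Some (Leaf g)) (1::'f)) = gn g * 1"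
    by (simp add: gn_def UM_emb.abs_eq free_emb_def UM_one_right)
  then show ?case
    using gn_mult_span[OF mon_in_span[of 0 0 0 0 0]] by (simp add: mon_0)
next
  case (Node u v)
  have "abs_UM (Poly_Mapping.single (Some (Node u v)) (1::'f))
      = abs_UM (Poly_Mapping.single (Some u) 1) * abs_UM (Poly_Mapping.single (Some v) 1)"
    by (simp add: times_UM.abs_eq free_mult_def)
  then show ?case using Node by (simp add: span_mult)
qed

lemma span_mons: "UM.span mons = (UNIV :: 'f UM set)"
proof -
  have single: "abs_UM (Poly_Mapping.single w (k::'f)) \<in> UM.span mons" for w k
  proof -
    have "Poly_Mapping.single w k = pm_scale k (Poly_Mapping.single w 1)"
      by (rule poly_mapping_eqI) (simp add: lookup_single when_def)
    then have "abs_UM (Poly_Mapping.single w k) = k *\<^sub>U abs_UM (Poly_Mapping.single w 1)"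
      by (simp add: scale_UM.abs_eq)
    moreover have "abs_UM (Poly_Mapping.single w (1::'f)) \<in> UM.span mons"
    proof (cases w)
      case None
      then have "abs_UM (Poly_Mapping.single w (1::'f)) = mon 0 0 0 0 0"
        by (simp add: mon_0 one_UM.abs_eq free_one_def)
      then show ?thesis by (simp add: mon_in_span)
    qed (simp add: word_in_span)
    ultimately show ?thesis by (simp add: UM.span_scale)
  qed
  have sum: "abs_UM (\<Sum>w\<in>A. Poly_Mapping.single w (v w)) \<in> UM.span mons" if "finite A" for A and v :: "_ \<Rightarrow> 'f"
    using that
    by induction (auto simp: UM.span_zero single UM.span_add simp flip: zero_UM.abs_eq plus_UM.abs_eq)
  have "x \<in> UM.span mons" for x :: "'f UM"
  proof (induction x rule: UM.abs_induct)
    case (1 p)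
    have "p = (\<Sum>w\<in>Poly_Mapping.keys p. Poly_Mapping.single w (Poly_Mapping.lookup p w))"
      by (rule poly_mapping_eqI) (auto simp: lookup_sum lookup_single when_def in_keys_iff)
    then show ?case using sum[of "Poly_Mapping.keys p" "Poly_Mapping.lookup p"] by simp
  qed
  then show ?thesis by blast
qed

text \<open>As the monomials span, a linear identity in U(M) has only to be checked on them.\<close>

lemma UM_induct [case_names mon add scale]:
  fixes x :: "'f UM"
  assumes "\<And>i j k l m. P (M i j k l m)" "\<And>x y. P x \<Longrightarrow> P y \<Longrightarrow> P (x + y)" "\<And>t x. P x \<Longrightarrow> P (t *\<^sub>U x)"
  shows "P x"
proof -
  have "x \<in> UM.span mons" by (simp add: span_mons)
  then show ?thesis
  proof (induction rule: UM.span_induct_alt)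
    case base
    show ?case using assms(3)[OF assms(1), of 0] by simp
  next
    case (step t x y)
    then show ?case using assms by (auto simp: mons_def)
  qed
qed

text \<open>Up to a factor 6, these are the associators \<open>(b, d, x)\<close>, \<open>- (a, d, x)\<close> and \<open>(a, b, x)\<close>;
  in differential notation they are \<open>e \<partial>\<^sub>a\<close>, \<open>e \<partial>\<^sub>b\<close> and \<open>e \<partial>\<^sub>d\<close>.\<close>

definition X :: "'f UM \<Rightarrow> 'f UM" where "X x = ad d (ad b x) - ad b (ad d x)"
definition Y :: "'f UM \<Rightarrow> 'f UM" where "Y x = ad a (ad d x) - ad d (ad a x)"
definition Z :: "'f UM \<Rightarrow> 'f UM" where "Z x = - ad c x"

lemma X_lin: "X (x + y) = X x + X y" "X (x - y) = X x - X y" "X (- x) = - X x" "X (k *\<^sub>U x) = k *\<^sub>U X x" "X 0 = 0"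
  and Y_lin: "Y (x + y) = Y x + Y y" "Y (x - y) = Y x - Y y" "Y (- x) = - Y x" "Y (k *\<^sub>U x) = k *\<^sub>U Y x" "Y 0 = 0"
  and Z_lin: "Z (x + y) = Z x + Z y" "Z (x - y) = Z x - Z y" "Z (- x) = - Z x" "Z (k *\<^sub>U x) = k *\<^sub>U Z x" "Z 0 = 0"
  by (simp_all add: X_def Y_def Z_def UM.scale_right_diff_distrib)

lemmas lin_simps = X_lin Y_lin Z_lin UM_algebra UM.scale_right_distrib UM.scale_right_diff_distrib

lemma X_mon: "X (M i j k l m) = s i (M (i - 1) j k l (Suc m))"
  unfolding X_def by (cases i; cases j; cases k; cases l) (simp_all add: action_simps actions del: of_nat_Suc UM.scale_scale)

lemma Y_mon: "Y (M i j k l m) = s j (M i (j - 1) k l (Suc m))"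
  unfolding Y_def by (cases i; cases j; cases k; cases l) (simp_all add: action_simps actions del: of_nat_Suc UM.scale_scale)

lemma Z_mon: "Z (M i j k l m) = s l (M i j k (l - 1) (Suc m))"
  unfolding Z_def by (simp add: actions)

lemmas all_actions = actions X_mon Y_mon Z_mon

section \<open>Commutation relations between the operators\<close>

lemma ad_e: "ad e x = (0 :: 'f UM)"
  by (induct x rule: UM_induct) (simp_all add: actions)

text \<open>Each commutation rule is linear in its argument: it is computed on monomials first and
  then extended by \<open>UM_induct\<close>. Splitting exponents into zero and successor removes
  truncated subtraction.\<close>

lemma e_commute_mon:
  "X (e * M i j k l m) = e * X (M i j k l m)"
  "Y (e * M i j k l m) = e * Y (M i j k l m)"
  "Z (e * M i j k l m) = e * Z (M i j k l m)"
  "a * (e * M i j k l m) = e * (a * M i j k l m)"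
  "b * (e * M i j k l m) = e * (b * M i j k l m)"
  "c * (e * M i j k l m) = e * (c * M i j k l m)"
  "d * (e * M i j k l m) = e * (d * M i j k l m)"
  "ad a (e * M i j k l m) = e * ad a (M i j k l m)"
  "ad b (e * M i j k l m) = e * ad b (M i j k l m)"
  "ad d (e * M i j k l m) = e * ad d (M i j k l m)"
  by (cases i; cases j; cases k; cases l; simp add: action_simps all_actions lin_simps del: of_nat_Suc UM.scale_scale)+

lemma e_commute:
  "X (e * x) = e * X x"
  "Y (e * x) = e * Y x"
  "Z (e * x) = e * Z x"
  "a * (e * x) = e * (a * x)"
  "b * (e * x) = e * (b * x)"
  "c * (e * x) = e * (c * x)"
  "d * (e * x) = e * (d * x)"
  "ad a (e * x) = e * ad a x"
  "ad b (e * x) = e * ad b x"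
  "ad d (e * x) = e * ad d x"
  for x :: "'f UM"
  by (induct x rule: UM_induct; simp add: lin_simps e_commute_mon)+

lemma c_commute_mon:
  "a * (c * M i j k l m) = c * (a * M i j k l m)"
  "b * (c * M i j k l m) = c * (b * M i j k l m)"
  "ad a (c * M i j k l m) = c * ad a (M i j k l m)"
  "ad b (c * M i j k l m) = c * ad b (M i j k l m)"
  by (cases i; cases j; cases k; cases l; simp add: action_simps all_actions lin_simps del: of_nat_Suc UM.scale_scale)+

lemma c_commute:
  "a * (c * x) = c * (a * x)"
  "b * (c * x) = c * (b * x)"
  "ad a (c * x) = c * ad a x"
  "ad b (c * x) = c * ad b x"
  for x :: "'f UM"
  by (induct x rule: UM_induct; simp add: lin_simps c_commute_mon)+

lemma X_commute_mon:
  "X (b * M i j k l m) = b * X (M i j k l m)"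
  "X (c * M i j k l m) = c * X (M i j k l m)"
  "X (d * M i j k l m) = d * X (M i j k l m)"
  "X (Y (M i j k l m)) = Y (X (M i j k l m))"
  "X (Z (M i j k l m)) = Z (X (M i j k l m))"
  "X (ad a (M i j k l m)) = ad a (X (M i j k l m))"
  "X (ad b (M i j k l m)) = ad b (X (M i j k l m))"
  by (cases i; cases j; cases k; cases l; simp add: action_simps all_actions lin_simps del: of_nat_Suc UM.scale_scale)+

lemma X_commute:
  "X (b * x) = b * X x"
  "X (c * x) = c * X x"
  "X (d * x) = d * X x"
  "X (Y x) = Y (X x)"
  "X (Z x) = Z (X x)"
  "X (ad a x) = ad a (X x)"
  "X (ad b x) = ad b (X x)"
  for x :: "'f UM"
  by (induct x rule: UM_induct; simp add: lin_simps X_commute_mon)+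

lemma Y_commute_mon:
  "Y (a * M i j k l m) = a * Y (M i j k l m)"
  "Y (c * M i j k l m) = c * Y (M i j k l m)"
  "Y (d * M i j k l m) = d * Y (M i j k l m)"
  "Y (Z (M i j k l m)) = Z (Y (M i j k l m))"
  "Y (ad a (M i j k l m)) = ad a (Y (M i j k l m))"
  "Y (ad b (M i j k l m)) = ad b (Y (M i j k l m))"
  by (cases i; cases j; cases k; cases l; simp add: action_simps all_actions lin_simps del: of_nat_Suc UM.scale_scale)+

lemma Y_commute:
  "Y (a * x) = a * Y x"
  "Y (c * x) = c * Y x"
  "Y (d * x) = d * Y x"
  "Y (Z x) = Z (Y x)"
  "Y (ad a x) = ad a (Y x)"
  "Y (ad b x) = ad b (Y x)"
  for x :: "'f UM"
  by (induct x rule: UM_induct; simp add: lin_simps Y_commute_mon)+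

lemma Z_commute_mon:
  "Z (a * M i j k l m) = a * Z (M i j k l m)"
  "Z (b * M i j k l m) = b * Z (M i j k l m)"
  "Z (c * M i j k l m) = c * Z (M i j k l m)"
  "Z (d * M i j k l m) = d * Z (M i j k l m) + e * M i j k l m"
  "Z (ad a (M i j k l m)) = ad a (Z (M i j k l m))"
  "Z (ad b (M i j k l m)) = ad b (Z (M i j k l m))"
  by (cases i; cases j; cases k; cases l; simp add: action_simps all_actions lin_simps del: of_nat_Suc UM.scale_scale)+

lemma Z_commute:
  "Z (a * x) = a * Z x"
  "Z (b * x) = b * Z x"
  "Z (c * x) = c * Z x"
  "Z (d * x) = d * Z x + e * x"
  "Z (ad a x) = ad a (Z x)"
  "Z (ad b x) = ad b (Z x)"
  for x :: "'f UM"
  by (induct x rule: UM_induct; simp add: lin_simps Z_commute_mon)+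

lemma ad_ad_commute_mon: "ad a (ad b (M i j k l m)) = ad b (ad a (M i j k l m))"
  by (cases i; cases j; cases k; cases l; simp add: action_simps all_actions lin_simps del: of_nat_Suc UM.scale_scale)

lemma ad_ad_commute: "ad a (ad b x) = ad b (ad a x)" for x :: "'f UM"
  by (induct x rule: UM_induct) (simp_all add: lin_simps ad_ad_commute_mon)

text \<open>By \<open>ad_step\<close>, the corrections come from the bracket [a, b] = c, giving
  \<open>c\<close> and \<open>Z\<close>, and from the commutators of \<open>ad d\<close> with
  \<open>ad a\<close> and \<open>ad b\<close>, giving \<open>Y\<close> and \<open>X\<close>.\<close>

lemma ad_commute:
  "ad a (a * x) = a * ad a x"
  "ad a (b * x) = b * ad a x - c * x + h3 *\<^sub>U Z x"
  "ad a (d * x) = d * ad a x - h3 *\<^sub>U Y x"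
  "ad b (b * x) = b * ad b x"
  "ad b (d * x) = d * ad b x + h3 *\<^sub>U X x"
  "ad d (d * x) = d * ad d x"
  for x :: "'f UM"
  by (simp_all add: ad_step ad_gens ad_gens' ad_ad_commute X_def Y_def Z_def UM.scale_right_diff_distrib)

lemmas comm_simps = lin_simps ad_commute e_commute c_commute X_commute Y_commute Z_commute

section \<open>Recursions for products in the exponents of the left factor\<close>

lemma gn_mult_ad:
  fixes x y :: "'f UM"
  assumes "ad (gn f) (y * x) = ad (gn f) y * x + y * ad (gn f) x + h3 *\<^sub>U z"
  shows "(gn f * y) * x = gn f * (y * x) + h *\<^sub>U z"
proof -
  \<comment> \<open>The associator is a third of the failure of the product rule, which is half of
    \<open>z\<close>: together 1/6.\<close>
  have "h2 * h3 = h"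
    using h6 by (simp add: h2_def h3_def mult_ac)
  then show ?thesis
    unfolding gn_mult_mult assoc_gn_ad assms by simp
qed

lemma gn_mult_ad_0:
  fixes x y :: "'f UM"
  assumes "ad (gn f) (y * x) = ad (gn f) y * x + y * ad (gn f) x"
  shows "(gn f * y) * x = gn f * (y * x)"
  using gn_mult_ad[of f y x 0] assms by simp

lemma e_mult: "(e * y) * x = e * (y * x)" for x y :: "'f UM"
  by (rule gn_mult_ad_0) (simp add: ad_e)

lemma mon_Ge_mult: "M i j k l (Suc m) * x = e * (M i j k l m * x)"
  by (simp add: actions flip: e_mult)

text \<open>Pattern of the following lemmas: the rule for the adjoint action at one exponent gives
  the multiplication rule for one more letter, and this gives the rule for the adjoint action at the
  next exponent.\<close>

lemma ad_d_mult: "ad d (M 0 0 0 l m * x) = M 0 0 0 l m * ad d x"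
proof (induction l arbitrary: m x)
  case 0
  show ?case by (induction m) (simp_all add: mon_0 UM_one_left mon_Ge_mult comm_simps)
next
  case (Suc l)
  have "M 0 0 0 (Suc l) m * x = d * (M 0 0 0 l m * x)" for x
    unfolding mon_Gd[symmetric] by (intro gn_mult_ad_0) (simp add: actions Suc)
  then show ?case using Suc by (simp add: comm_simps)
qed

lemma mon_Gd_mult: "M 0 0 0 (Suc l) m * x = d * (M 0 0 0 l m * x)"
  unfolding mon_Gd[symmetric] by (intro gn_mult_ad_0) (simp add: actions ad_d_mult)

lemma Z_1 [simp]: "Z 1 = 0"
  by (simp add: Z_def)

text \<open>The associator with \<open>c\<close> measures the failure of the product rule for
  \<open>Z\<close>, which is \<open>- ad c\<close>. The next lemmas establish that rule, so
  \<open>c\<close> can be pulled out of the left factor.\<close>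

lemma c_mult:
  assumes "Z (y * x) = Z y * x + y * Z x"
  shows "(c * y) * x = c * (y * x)"
proof (rule gn_mult_ad_0)
  have "- ad c (y * x) = - (ad c y * x + y * ad c x)"
    using assms by (simp add: Z_def)
  then show "ad c (y * x) = ad c y * x + y * ad c x"
    by (simp only: neg_equal_iff_equal)
qed

lemma Z_mult_d: "Z (M 0 0 0 l m * x) = Z (M 0 0 0 l m) * x + M 0 0 0 l m * Z x"
proof (induction l arbitrary: m)
  case 0
  show ?case by (induction m) (simp_all add: mon_0 UM_one_left mon_Ge_mult comm_simps Z_mon)
next
  case (Suc l)
  then show ?case
    by (cases l) (simp_all add: mon_Gd_mult mon_Ge_mult comm_simps Z_mon s_Suc del: of_nat_Suc UM.scale_scale)
qed

lemma Z_mult_c: "Z (M 0 0 k l m * x) = Z (M 0 0 k l m) * x + M 0 0 k l m * Z x"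
proof (induction k arbitrary: l m x)
  case 0
  show ?case by (simp add: Z_mult_d)
next
  case (Suc k)
  have "M 0 0 (Suc k) l m * x = c * (M 0 0 k l m * x)" for l m x
    unfolding mon_Gc[symmetric] by (intro c_mult Suc)
  then show ?case using Suc by (simp add: comm_simps Z_mon)
qed

lemma mon_Gc_mult_c: "M 0 0 (Suc k) l m * x = c * (M 0 0 k l m * x)"
  unfolding mon_Gc[symmetric] by (intro c_mult Z_mult_c)

lemma mult_c_commute:
  "X (M 0 0 k l m * x) = M 0 0 k l m * X x"
  "Y (M 0 0 k l m * x) = M 0 0 k l m * Y x"
proof -
  have e: "X (M 0 0 0 0 m * x) = M 0 0 0 0 m * X x" "Y (M 0 0 0 0 m * x) = M 0 0 0 0 m * Y x" for m
    by (induction m) (simp_all add: mon_0 UM_one_left mon_Ge_mult comm_simps)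
  have d: "X (M 0 0 0 l m * x) = M 0 0 0 l m * X x" "Y (M 0 0 0 l m * x) = M 0 0 0 l m * Y x" for l
    by (induction l) (simp_all add: mon_Gd_mult comm_simps e)
  show "X (M 0 0 k l m * x) = M 0 0 k l m * X x" "Y (M 0 0 k l m * x) = M 0 0 k l m * Y x"
    by (induction k) (simp_all add: mon_Gc_mult_c comm_simps d)
qed

text \<open>Moving \<open>ad b\<close> or \<open>ad a\<close> past each of the \<open>l\<close>
  letters \<open>d\<close> costs half of \<open>X\<close> or minus half of \<open>Y\<close>; the
  letters \<open>c\<close> and \<open>e\<close> cost nothing.\<close>

lemma ad_mult_c:
  "ad b (M 0 0 k l m * x) = M 0 0 k l m * ad b x + h3 *\<^sub>U s l (M 0 0 k (l - 1) m * X x)"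
  "ad a (M 0 0 k l m * x) = M 0 0 k l m * ad a x - h3 *\<^sub>U s l (M 0 0 k (l - 1) m * Y x)"
proof -
  note [simp] = comm_simps s_Suc
  note [simp del] = of_nat_Suc UM.scale_scale
  have e: "ad b (M 0 0 0 0 m * x) = M 0 0 0 0 m * ad b x" "ad a (M 0 0 0 0 m * x) = M 0 0 0 0 m * ad a x" for m
    by (induction m) (simp_all add: mon_0 UM_one_left mon_Ge_mult)
  have d: "ad b (M 0 0 0 l m * x) = M 0 0 0 l m * ad b x + h3 *\<^sub>U s l (M 0 0 0 (l - 1) m * X x)"
    "ad a (M 0 0 0 l m * x) = M 0 0 0 l m * ad a x - h3 *\<^sub>U s l (M 0 0 0 (l - 1) m * Y x)" for l
  proof (induction l)
    case (Suc l)
    {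
      case 1
      then show ?case using Suc by (cases l) (simp_all add: mon_Gd_mult mult_c_commute)
    next
      case 2
      then show ?case using Suc by (cases l) (simp_all add: mon_Gd_mult mult_c_commute)
    }
  qed (simp_all add: e)
  show "ad b (M 0 0 k l m * x) = M 0 0 k l m * ad b x + h3 *\<^sub>U s l (M 0 0 k (l - 1) m * X x)"
    "ad a (M 0 0 k l m * x) = M 0 0 k l m * ad a x - h3 *\<^sub>U s l (M 0 0 k (l - 1) m * Y x)"
    by (induction k) (simp_all add: mon_Gc_mult_c d)
qed

lemma ad_b_mult:
  "ad b (M 0 j k l m * x) = M 0 j k l m * ad b x + h3 *\<^sub>U s l (M 0 j k (l - 1) m * X x)"
proof (induction j arbitrary: l x)
  case 0
  show ?case by (simp add: ad_mult_c)
next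
  case (Suc j)
  have "M 0 (Suc j) k l m * x = b * (M 0 j k l m * x) + h *\<^sub>U s l (M 0 j k (l - 1) m * X x)" for l x
    unfolding mon_Gb[symmetric] by (rule gn_mult_ad) (simp add: Suc actions)
  then show ?case
    by (simp add: Suc comm_simps UM.scale_left_commute del: UM.scale_scale)
qed

lemma mon_Gb_mult:
  "M 0 (Suc j) k l m * x = b * (M 0 j k l m * x) + h *\<^sub>U s l (M 0 j k (l - 1) m * X x)"
  unfolding mon_Gb[symmetric] by (rule gn_mult_ad) (simp add: ad_b_mult actions)

lemma Z_mult_b: "Z (M 0 j k l m * x) = Z (M 0 j k l m) * x + M 0 j k l m * Z x"
proof (induction j arbitrary: l m x)
  case 0
  show ?case by (simp add: Z_mult_c)
next
  case (Suc j)
  then show ?case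
    by (simp add: mon_Gb_mult Z_mon comm_simps UM.scale_left_commute del: UM.scale_scale)
qed

lemma mon_Gc_mult_b: "M 0 j (Suc k) l m * x = c * (M 0 j k l m * x)"
  using c_mult[OF Z_mult_b, of j k l m x] by (simp add: actions)

lemma ad_a_mult_b:
  "ad a (M 0 j k l m * x) = ad a (M 0 j k l m) * x + M 0 j k l m * ad a x
    + h3 *\<^sub>U (s j (M 0 (j - 1) k l m * Z x) - s l (M 0 j k (l - 1) m * Y x))"
proof (induction j arbitrary: l m x)
  case 0
  show ?case by (simp add: ad_mult_c actions)
next
  case (Suc j)
  have "ad a (M 0 (Suc j) k l m * x) = b * ad a (M 0 j k l m * x) - c * (M 0 j k l m * x) + h3 *\<^sub>U Z (M 0 j k l m * x)
      + h *\<^sub>U s l (ad a (M 0 j k (l - 1) m * X x))"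
    by (simp add: mon_Gb_mult ad_commute)
  then show ?case
    unfolding Suc by (cases j) (simp_all add: mon_Gb_mult mon_Gc_mult_b mon_Ge_mult Z_mult_b actions Z_mon comm_simps s_Suc UM.scale_left_commute
      del: of_nat_Suc UM.scale_scale)
qed

lemma ad_a_mult:
  "ad a (M i j k l m * x) = ad a (M i j k l m) * x + M i j k l m * ad a x
    + h3 *\<^sub>U (s j (M i (j - 1) k l m * Z x) - s l (M i j k (l - 1) m * Y x))"
proof (induction i arbitrary: j k l m x)
  case 0
  show ?case by (rule ad_a_mult_b)
next
  case (Suc i)
  have *: "M (Suc i) j k l m * x = a * (M i j k l m * x)
    + h *\<^sub>U (s j (M i (j - 1) k l m * Z x) - s l (M i j k (l - 1) m * Y x))" for j k l m x
    unfolding mon_Ga[symmetric] by (rule gn_mult_ad) (rule Suc)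
  show ?case
    by (simp add: * Suc actions comm_simps UM.scale_left_commute del: UM.scale_scale)
qed

text \<open>In generating functions the correction to \<open>a\<close> is
  \<open>(e/6) (y \<partial>\<^sub>d - u \<partial>\<^sub>b)\<close>, with the derivatives acting on
  the right factor.\<close>

lemma mon_Ga_mult:
  "M (Suc i) j k l m * x = a * (M i j k l m * x)
    + h *\<^sub>U (s j (M i (j - 1) k l m * Z x) - s l (M i j k (l - 1) m * Y x))"
  unfolding mon_Ga[symmetric] by (rule gn_mult_ad) (rule ad_a_mult)

lemma Z_mult: "Z (M i j k l m * x) = s l (e * (M i j k (l - 1) m * x)) + M i j k l m * Z x"
proof (induction i arbitrary: j l x)
  case 0
  show ?case by (simp add: Z_mult_b Z_mon mon_Ge_mult UM_algebra)
next
  case (Suc i)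
  then show ?case
    by (simp add: mon_Ga_mult comm_simps UM.scale_left_commute del: UM.scale_scale)
qed

end

section \<open>Normal ordering\<close>

text \<open>Multiples by natural numbers for all additive groups, since the binomial theorem is applied to
  operators on function spaces, which are not vector spaces in the sense of a type class.\<close>

primrec nsmul :: "nat \<Rightarrow> 'a::ab_group_add \<Rightarrow> 'a" where
  "nsmul 0 x = 0"
| "nsmul (Suc n) x = x + nsmul n x"

lemma nsmul_add_left: "nsmul (m + n) x = nsmul m x + nsmul n x"
  by (induction m) (simp_all add: add.assoc)

lemma nsmul_fun: "nsmul n f i = nsmul n (f i)"
  by (induction n) simp_all

lemma nsmul_UM: "nsmul n x = of_nat n *\<^sub>U x"
  by (induction n) (simp_all add: UM.scale_left_distrib)

lemma additive_nsmul:
  assumes "additive f"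
  shows "f (nsmul n x) = nsmul n (f x)"
  by (induction n) (simp_all add: additive.zero[OF assms] additive.add[OF assms])

text \<open>Pascal's rule, with commutation moving \<open>V\<close> inside the power of
  \<open>U\<close>. Stated for abelian groups so that \<open>U\<close> and \<open>V\<close> may act
  on families of operators.\<close>

lemma binomial_funpow:
  fixes U V :: "'a::ab_group_add \<Rightarrow> 'a"
  assumes U: "additive U" and V: "additive V" and UV: "\<And>x. U (V x) = V (U x)"
  shows "((\<lambda>x. U x + V x) ^^ n) x = (\<Sum>k\<le>n. nsmul (n choose k) ((U ^^ k) ((V ^^ (n - k)) x)))"
proof (induction n)
  case (Suc n)
  have VU: "V ((U ^^ k) y) = (U ^^ k) (V y)" for k y
    by (induction k) (simp_all flip: UV)
  let ?t = "\<lambda>k. (U ^^ k) ((V ^^ (Suc n - k)) x)"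
  have "((\<lambda>x. U x + V x) ^^ Suc n) x = (\<Sum>k\<le>n. nsmul (n choose k) (?t (Suc k)))
      + (\<Sum>k\<le>n. nsmul (n choose k) (V ((U ^^ k) ((V ^^ (n - k)) x))))"
    by (simp add: Suc additive.sum[OF U] additive.sum[OF V] additive_nsmul[OF U] additive_nsmul[OF V])
  also have "(\<Sum>k\<le>n. nsmul (n choose k) (V ((U ^^ k) ((V ^^ (n - k)) x)))) = (\<Sum>k\<le>n. nsmul (n choose k) (?t k))"
    by (intro sum.cong refl) (simp add: VU Suc_diff_le)
  also have "\<dots> = (\<Sum>k\<le>Suc n. nsmul (n choose k) (?t k))"
    by (simp add: binomial_eq_0)
  also have "\<dots> = ?t 0 + (\<Sum>k\<le>n. nsmul (n choose Suc k) (?t (Suc k)))"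
    by (subst sum.atMost_Suc_shift) simp
  also have "(\<Sum>k\<le>n. nsmul (n choose k) (?t (Suc k))) + \<dots> = (\<Sum>k\<le>Suc n. nsmul (Suc n choose k) (?t k))"
    by (subst sum.atMost_Suc_shift) (simp add: nsmul_add_left sum.distrib add_ac)
  finally show ?case .
qed simp

lemma additive_plus: "additive U \<Longrightarrow> additive V \<Longrightarrow> additive (\<lambda>f. U f + V f)"
  for U V :: "'a::ab_group_add \<Rightarrow> 'b::ab_group_add"
  by (simp add: additive_def)

text \<open>The scalar left by iterating an operator that multiplies by an exponent and lowers it.
  Beyond the exponent a factor 0 occurs, so truncated subtraction does no harm.\<close>

primrec ffact :: "nat \<Rightarrow> nat \<Rightarrow> nat" where
  "ffact n 0 = 1"
| "ffact n (Suc k) = n * ffact (n - 1) k"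

lemma ffact_Suc_right: "ffact n (Suc k) = ffact n k * (n - k)"
proof (induction k arbitrary: n)
  case (Suc k)
  show ?case by (subst ffact.simps(2), subst Suc) simp
qed simp

lemma sum_fun_apply: "(\<Sum>i\<in>A. f i) x = (\<Sum>i\<in>A. f i x)"
  by (induction A rule: infinite_finite_induct) simp_all

lemma ffact_add: "ffact n (j + k) = ffact n j * ffact (n - j) k"
  by (induction j arbitrary: n) simp_all

section \<open>Powers of operators on monomials\<close>

context inv6
begin

abbreviation mult_pow :: "'f UM \<Rightarrow> nat \<Rightarrow> 'f UM \<Rightarrow> 'f UM" where
  "mult_pow y n x \<equiv> (((*) y) ^^ n) x"

lemma pow_mon:
  "(X ^^ n) (M p q r u t) = s (ffact p n) (M (p - n) q r u (t + n))"
  "(Y ^^ n) (M p q r u t) = s (ffact q n) (M p (q - n) r u (t + n))"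
  "(Z ^^ n) (M p q r u t) = s (ffact u n) (M p q r (u - n) (t + n))"
  "mult_pow a n (M p q r u t) = M (p + n) q r u t"
  "mult_pow c n (M p q r u t) = M p q (r + n) u t"
  "mult_pow e n (M p q r u t) = M p q r u (t + n)"
  by (induction n) (simp_all add: mon_Ga actions X_mon X_lin Y_mon Y_lin Z_mon Z_lin ffact_Suc_right del: ffact.simps(2))

lemma funpow_scale:
  "mult_pow y n (t *\<^sub>U x) = t *\<^sub>U mult_pow y n x"
  "(X ^^ n) (t *\<^sub>U x) = t *\<^sub>U (X ^^ n) x"
  "(Y ^^ n) (t *\<^sub>U x) = t *\<^sub>U (Y ^^ n) x"
  "(Z ^^ n) (t *\<^sub>U x) = t *\<^sub>U (Z ^^ n) x"
  by (induction n) (simp_all add: lin_simps)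

lemma mult_pow_add: "mult_pow y n (x + z) = mult_pow y n x + mult_pow y n z"
  and mult_pow_diff: "mult_pow y n (x - z) = mult_pow y n x - mult_pow y n z"
  by (induction n) (simp_all add: lin_simps)

lemma mult_pow_sum: "mult_pow y n (sum f A) = (\<Sum>x\<in>A. mult_pow y n (f x))"
  by (rule additive.sum) (simp add: additive_def mult_pow_add)

lemma Z_pow_sum: "(Z ^^ n) (sum f A) = (\<Sum>x\<in>A. (Z ^^ n) (f x))"
  by (rule additive.sum, simp add: additive_def, induction n) (simp_all add: lin_simps)

section \<open>Left multiplication by monomials as a sum of operator products\<close>

lemma mult_c_eq: "M 0 0 k l m * x = mult_pow c k (mult_pow d l (mult_pow e m x))"
proof -
  have "M 0 0 0 0 m * x = mult_pow e m x"
    by (induction m) (simp_all add: mon_0 UM_one_left mon_Ge_mult)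
  then have "M 0 0 0 l m * x = mult_pow d l (mult_pow e m x)"
    by (induction l) (simp_all add: mon_Gd_mult)
  then show ?thesis
    by (induction k) (simp_all add: mon_Gc_mult_c)
qed

text \<open>The recursions of left multiplication in the exponents of the left factor are sums of commuting
  operators on families indexed by the remaining exponents.\<close>

definition bB :: "(nat \<Rightarrow> 'f UM \<Rightarrow> 'f UM) \<Rightarrow> nat \<Rightarrow> 'f UM \<Rightarrow> 'f UM" where
  "bB f = (\<lambda>l x. b * f l x)"

definition bX :: "(nat \<Rightarrow> 'f UM \<Rightarrow> 'f UM) \<Rightarrow> nat \<Rightarrow> 'f UM \<Rightarrow> 'f UM" where
  "bX f = (\<lambda>l x. h *\<^sub>U s l (f (l - 1) (X x)))"

lemma bB_funpow: "(bB ^^ n) f l x = mult_pow b n (f l x)"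
  by (induction n) (simp_all add: bB_def)

lemma bX_funpow: "(bX ^^ n) f l x = h ^ n *\<^sub>U s (ffact l n) (f (l - n) ((X ^^ n) x))"
proof (induction n arbitrary: l x)
  case (Suc n)
  have "(bX ^^ Suc n) f l x = h *\<^sub>U s l ((bX ^^ n) f (l - 1) (X x))"
    by (simp add: bX_def)
  then show ?case by (simp add: Suc funpow_swap1 mult_ac)
qed simp

text \<open>By \<open>mon_Gb_mult\<close>, raising \<open>j\<close> applies \<open>bX + bB\<close>.
  These commute, and \<mu> counts the factors \<open>bX\<close>, that is
  \<open>y u (e/6) \<partial>\<^sub>a\<close> in generating functions.\<close>

lemma mult_b_eq:
  "M 0 j k l m * x = (\<Sum>\<mu>\<le>j. s (j choose \<mu>) (h ^ \<mu> *\<^sub>U s (ffact l \<mu>)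
     (mult_pow b (j - \<mu>) (mult_pow c k (mult_pow d (l - \<mu>) (mult_pow e m ((X ^^ \<mu>) x)))))))"
proof -
  let ?f = "\<lambda>j l x. M 0 j k l m * x"
  have "?f (Suc j) = bX (?f j) + bB (?f j)" for j
    by (intro ext) (simp add: mon_Gb_mult bX_def bB_def)
  then have "?f j = ((\<lambda>f. bX f + bB f) ^^ j) (?f 0)"
    by (induction j) simp_all
  also have "\<dots> = (\<Sum>\<mu>\<le>j. nsmul (j choose \<mu>) ((bX ^^ \<mu>) ((bB ^^ (j - \<mu>)) (?f 0))))"
    by (rule binomial_funpow) (auto simp: additive_def fun_eq_iff bB_def bX_def lin_simps)
  finally have "?f j = \<dots>" .
  from this[THEN fun_cong, THEN fun_cong, of l x] show ?thesis
    by (simp add: nsmul_fun nsmul_UM sum_fun_apply bX_funpow bB_funpow mult_c_eq)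
qed

definition aA :: "(nat \<Rightarrow> nat \<Rightarrow> 'f UM \<Rightarrow> 'f UM) \<Rightarrow> nat \<Rightarrow> nat \<Rightarrow> 'f UM \<Rightarrow> 'f UM" where
  "aA f = (\<lambda>j l x. a * f j l x)"

text \<open>The correction arising when \<open>Z\<close> is moved from the right factor to the
  outside of the product by \<open>Z_mult\<close>.\<close>

definition aE :: "(nat \<Rightarrow> nat \<Rightarrow> 'f UM \<Rightarrow> 'f UM) \<Rightarrow> nat \<Rightarrow> nat \<Rightarrow> 'f UM \<Rightarrow> 'f UM" where
  "aE f = (\<lambda>j l x. (- h) *\<^sub>U s j (s l (e * f (j - 1) (l - 1) x)))"

definition aY :: "(nat \<Rightarrow> nat \<Rightarrow> 'f UM \<Rightarrow> 'f UM) \<Rightarrow> nat \<Rightarrow> nat \<Rightarrow> 'f UM \<Rightarrow> 'f UM" where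
  "aY f = (\<lambda>j l x. (- h) *\<^sub>U s l (f j (l - 1) (Y x)))"

definition aZ :: "(nat \<Rightarrow> nat \<Rightarrow> 'f UM \<Rightarrow> 'f UM) \<Rightarrow> nat \<Rightarrow> nat \<Rightarrow> 'f UM \<Rightarrow> 'f UM" where
  "aZ f = (\<lambda>j l x. h *\<^sub>U s j (Z (f (j - 1) l x)))"

lemma aA_funpow: "(aA ^^ n) f j l x = mult_pow a n (f j l x)"
  by (induction n) (simp_all add: aA_def)

lemma aE_funpow: "(aE ^^ n) f j l x = (- h) ^ n *\<^sub>U s (ffact j n) (s (ffact l n) (mult_pow e n (f (j - n) (l - n) x)))"
proof (induction n arbitrary: j l)
  case (Suc n)
  have "(aE ^^ Suc n) f j l x = (- h) *\<^sub>U s j (s l (e * (aE ^^ n) f (j - 1) (l - 1) x))"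
    by (simp add: aE_def)
  then show ?case by (simp add: Suc mult_ac UM_algebra)
qed simp

lemma aY_funpow: "(aY ^^ n) f j l x = (- h) ^ n *\<^sub>U s (ffact l n) (f j (l - n) ((Y ^^ n) x))"
proof (induction n arbitrary: l x)
  case (Suc n)
  have "(aY ^^ Suc n) f j l x = (- h) *\<^sub>U s l ((aY ^^ n) f j (l - 1) (Y x))"
    by (simp add: aY_def)
  then show ?case by (simp add: Suc funpow_swap1 mult_ac)
qed simp

lemma aZ_funpow: "(aZ ^^ n) f j l x = h ^ n *\<^sub>U s (ffact j n) ((Z ^^ n) (f (j - n) l x))"
proof (induction n arbitrary: j)
  case (Suc n)
  have "(aZ ^^ Suc n) f j l x = h *\<^sub>U s j (Z ((aZ ^^ n) f (j - 1) l x))"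
    by (simp add: aZ_def)
  then show ?case by (simp add: Suc mult_ac lin_simps)
qed simp

lemma additive_a: "additive aA" "additive aE" "additive aY" "additive aZ"
  by (auto simp: additive_def fun_eq_iff aA_def aE_def aY_def aZ_def lin_simps)

text \<open>Three nested binomial expansions: \<open>aA\<close> is split off first, then
  \<open>aE\<close>, then \<open>aY\<close> from \<open>aZ\<close>. The factors \<open>aA\<close>,
  \<open>aE\<close>, \<open>aY\<close>, \<open>aZ\<close> occur \<open>i - \<beta>\<close>,
  \<open>\<beta> - \<gamma>\<close>, \<open>\<gamma> - \<delta>\<close> and \<delta> times.\<close>

lemma mult_a_eq:
  "M i j k l m * x = (\<Sum>\<beta>\<le>i. \<Sum>\<gamma>\<le>\<beta>. \<Sum>\<delta>\<le>\<gamma>. s ((i choose \<beta>) * (\<beta> choose \<gamma>) * (\<gamma> choose \<delta>))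
    ((aZ ^^ \<delta>) ((aY ^^ (\<gamma> - \<delta>)) ((aE ^^ (\<beta> - \<gamma>)) ((aA ^^ (i - \<beta>)) (\<lambda>j l x. M 0 j k l m * x)))) j l x))"
proof -
  let ?f = "\<lambda>i j l x. M i j k l m * x"
  note additive = additive_a
    additive_plus[OF additive_a(4,3)] additive_plus[OF additive_plus[OF additive_a(4,3)] additive_a(2)]
  have commute: "aZ (aY f) = aY (aZ f)" "aZ (aE f) + aY (aE f) = aE (aZ f + aY f)"
    "(aZ (aA f) + aY (aA f)) + aE (aA f) = aA ((aZ f + aY f) + aE f)" for f
    by (auto simp: fun_eq_iff aA_def aE_def aY_def aZ_def comm_simps mult_ac)
  \<comment> \<open>\<open>Z_mult\<close> moves \<open>Z\<close> to the outside of the product, the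
    form behind the stated formula; the price is \<open>aE\<close>.\<close>
  have step: "?f (Suc i) = ((aZ (?f i) + aY (?f i)) + aE (?f i)) + aA (?f i)" for i
    by (intro ext) (simp add: mon_Ga_mult aA_def aE_def aY_def aZ_def Z_mult lin_simps UM.scale_left_commute del: UM.scale_scale)
  have "?f i = ((\<lambda>f. ((aZ f + aY f) + aE f) + aA f) ^^ i) (?f 0)"
  proof (induction i)
    case (Suc i)
    show ?case using step[of i] by (simp only: Suc.IH funpow.simps comp_apply)
  qed simp
  also have "\<dots> = (\<Sum>\<beta>\<le>i. nsmul (i choose \<beta>) (((\<lambda>f. (aZ f + aY f) + aE f) ^^ \<beta>) ((aA ^^ (i - \<beta>)) (?f 0))))"
    by (rule binomial_funpow[OF additive(6,1), OF commute(3)])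
  also have "\<dots> = (\<Sum>\<beta>\<le>i. nsmul (i choose \<beta>) (\<Sum>\<gamma>\<le>\<beta>. nsmul (\<beta> choose \<gamma>)
      (((\<lambda>f. aZ f + aY f) ^^ \<gamma>) ((aE ^^ (\<beta> - \<gamma>)) ((aA ^^ (i - \<beta>)) (?f 0))))))"
    by (simp only: binomial_funpow[OF additive(5,2), OF commute(2)])
  also have "\<dots> = (\<Sum>\<beta>\<le>i. nsmul (i choose \<beta>) (\<Sum>\<gamma>\<le>\<beta>. nsmul (\<beta> choose \<gamma>) (\<Sum>\<delta>\<le>\<gamma>. nsmul (\<gamma> choose \<delta>)
      ((aZ ^^ \<delta>) ((aY ^^ (\<gamma> - \<delta>)) ((aE ^^ (\<beta> - \<gamma>)) ((aA ^^ (i - \<beta>)) (?f 0))))))))"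
    by (simp only: binomial_funpow[OF additive(4,3), OF commute(1)])
  finally have "?f i = \<dots>" .
  from this[THEN fun_cong, THEN fun_cong, THEN fun_cong, of j l x] show ?thesis
    by (simp add: nsmul_fun nsmul_UM sum_fun_apply UM.scale_sum_right mult.assoc)
qed

section \<open>Normal ordering of powers of d and b on monomials\<close>

text \<open>As a function of the five exponents, a monomial satisfies \<open>d * M = d1 M + d2 M + d3 M\<close> with
  commuting \<open>d1\<close>, \<open>d2\<close>, \<open>d3\<close>; likewise for \<open>b\<close>.\<close>

definition d1 :: "(nat \<Rightarrow> nat \<Rightarrow> nat \<Rightarrow> nat \<Rightarrow> nat \<Rightarrow> 'f UM) \<Rightarrow> nat \<Rightarrow> nat \<Rightarrow> nat \<Rightarrow> nat \<Rightarrow> nat \<Rightarrow> 'f UM" where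
  "d1 f = (\<lambda>p q r u t. f p q r (Suc u) t)"

definition d2 :: "(nat \<Rightarrow> nat \<Rightarrow> nat \<Rightarrow> nat \<Rightarrow> nat \<Rightarrow> 'f UM) \<Rightarrow> nat \<Rightarrow> nat \<Rightarrow> nat \<Rightarrow> nat \<Rightarrow> nat \<Rightarrow> 'f UM" where
  "d2 f = (\<lambda>p q r u t. (- 1) *\<^sub>U s r (f p q (r - 1) u (Suc t)))"

definition d3 :: "(nat \<Rightarrow> nat \<Rightarrow> nat \<Rightarrow> nat \<Rightarrow> nat \<Rightarrow> 'f UM) \<Rightarrow> nat \<Rightarrow> nat \<Rightarrow> nat \<Rightarrow> nat \<Rightarrow> nat \<Rightarrow> 'f UM" where
  "d3 f = (\<lambda>p q r u t. (- h2) *\<^sub>U s p (s q (f (p - 1) (q - 1) r u (Suc t))))"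

lemma d_funpow:
  "(d1 ^^ n) f p q r u t = f p q r (u + n) t"
  "(d2 ^^ n) f p q r u t = (- 1) ^ n *\<^sub>U s (ffact r n) (f p q (r - n) u (t + n))"
  "(d3 ^^ n) f p q r u t = (- h2) ^ n *\<^sub>U s (ffact p n) (s (ffact q n) (f (p - n) (q - n) r u (t + n)))"
proof (induction n arbitrary: p q r u t)
  case (Suc n)
  {
    case 1
    have "(d1 ^^ Suc n) f p q r u t = (d1 ^^ n) f p q r (Suc u) t"
      by (simp add: d1_def)
    then show ?case by (simp add: Suc)
  next
    case 2
    have "(d2 ^^ Suc n) f p q r u t = (- 1) *\<^sub>U s r ((d2 ^^ n) f p q (r - 1) u (Suc t))"
      by (simp add: d2_def)
    then show ?case by (simp add: Suc mult_ac)
  next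
    case 3
    have "(d3 ^^ Suc n) f p q r u t = (- h2) *\<^sub>U s p (s q ((d3 ^^ n) f (p - 1) (q - 1) r u (Suc t)))"
      by (simp add: d3_def)
    then show ?case by (simp add: Suc mult_ac)
  }
qed simp_all

lemma d_pow_mon:
  "mult_pow d n (M p q r u t) = (\<Sum>\<eta>\<le>n. \<Sum>\<theta>\<le>n - \<eta>. s ((n choose \<eta>) * ((n - \<eta>) choose \<theta>))
     ((- 1) ^ \<theta> *\<^sub>U s (ffact r \<theta>) ((- h2) ^ (n - \<eta> - \<theta>) *\<^sub>U s (ffact p (n - \<eta> - \<theta>)) (s (ffact q (n - \<eta> - \<theta>))
       (M (p - (n - \<eta> - \<theta>)) (q - (n - \<eta> - \<theta>)) (r - \<theta>) (u + \<eta>) (t + (n - \<eta>)))))))"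
proof -
  have additive: "additive d1" "additive d2" "additive d3"
    by (auto simp: additive_def fun_eq_iff d1_def d2_def d3_def lin_simps)
  have commute: "d2 (d3 f) = d3 (d2 f)" "d1 (d2 f + d3 f) = d2 (d1 f) + d3 (d1 f)" for f
    by (auto simp: fun_eq_iff d1_def d2_def d3_def mult_ac)
  let ?f = "\<lambda>n p q r u t. mult_pow d n (M p q r u t)"
  \<comment> \<open>The innermost factor \<open>d\<close> is expanded first, so that the shifts act
    on the exponents of the monomial below the other \<open>n\<close> factors.\<close>
  have step: "?f (Suc n) = d1 (?f n) + (d2 (?f n) + d3 (?f n))" for n
    unfolding funpow_Suc_right comp_apply
    by (intro ext) (simp add: d1_def d2_def d3_def actions mult_pow_add mult_pow_diff funpow_scale)
  have "?f n = ((\<lambda>f. d1 f + (d2 f + d3 f)) ^^ n) M"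
  proof (induction n)
    case (Suc n)
    show ?case using step[of n] by (simp only: Suc.IH funpow.simps comp_apply)
  qed simp
  also have "\<dots> = (\<Sum>\<eta>\<le>n. nsmul (n choose \<eta>) ((d1 ^^ \<eta>) (((\<lambda>f. d2 f + d3 f) ^^ (n - \<eta>)) M)))"
    by (rule binomial_funpow[OF additive(1) additive_plus[OF additive(2,3)], OF commute(2)])
  also have "\<dots> = (\<Sum>\<eta>\<le>n. nsmul (n choose \<eta>) ((d1 ^^ \<eta>) (\<Sum>\<theta>\<le>n - \<eta>. nsmul ((n - \<eta>) choose \<theta>)
      ((d2 ^^ \<theta>) ((d3 ^^ (n - \<eta> - \<theta>)) M)))))"
    by (simp only: binomial_funpow[OF additive(2,3), OF commute(1)])
  finally have "?f n = \<dots>" .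
  from this[THEN fun_cong, THEN fun_cong, THEN fun_cong, THEN fun_cong, THEN fun_cong, of p q r u t] show ?thesis
    by (simp add: nsmul_fun nsmul_UM sum_fun_apply d_funpow UM.scale_sum_right add_ac mult.assoc)
qed

definition b1 :: "(nat \<Rightarrow> nat \<Rightarrow> nat \<Rightarrow> nat \<Rightarrow> nat \<Rightarrow> 'f UM) \<Rightarrow> nat \<Rightarrow> nat \<Rightarrow> nat \<Rightarrow> nat \<Rightarrow> nat \<Rightarrow> 'f UM" where
  "b1 f = (\<lambda>p q r u t. f p (Suc q) r u t)"

definition b2 :: "(nat \<Rightarrow> nat \<Rightarrow> nat \<Rightarrow> nat \<Rightarrow> nat \<Rightarrow> 'f UM) \<Rightarrow> nat \<Rightarrow> nat \<Rightarrow> nat \<Rightarrow> nat \<Rightarrow> nat \<Rightarrow> 'f UM" where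
  "b2 f = (\<lambda>p q r u t. (- 1) *\<^sub>U s p (f (p - 1) q (Suc r) u t))"

definition b3 :: "(nat \<Rightarrow> nat \<Rightarrow> nat \<Rightarrow> nat \<Rightarrow> nat \<Rightarrow> 'f UM) \<Rightarrow> nat \<Rightarrow> nat \<Rightarrow> nat \<Rightarrow> nat \<Rightarrow> nat \<Rightarrow> 'f UM" where
  "b3 f = (\<lambda>p q r u t. h2 *\<^sub>U s p (s u (f (p - 1) q r (u - 1) (Suc t))))"

lemma b_funpow:
  "(b1 ^^ n) f p q r u t = f p (q + n) r u t"
  "(b2 ^^ n) f p q r u t = (- 1) ^ n *\<^sub>U s (ffact p n) (f (p - n) q (r + n) u t)"
  "(b3 ^^ n) f p q r u t = h2 ^ n *\<^sub>U s (ffact p n) (s (ffact u n) (f (p - n) q r (u - n) (t + n)))"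
proof (induction n arbitrary: p q r u t)
  case (Suc n)
  {
    case 1
    have "(b1 ^^ Suc n) f p q r u t = (b1 ^^ n) f p (Suc q) r u t"
      by (simp add: b1_def)
    then show ?case by (simp add: Suc)
  next
    case 2
    have "(b2 ^^ Suc n) f p q r u t = (- 1) *\<^sub>U s p ((b2 ^^ n) f (p - 1) q (Suc r) u t)"
      by (simp add: b2_def)
    then show ?case by (simp add: Suc mult_ac)
  next
    case 3
    have "(b3 ^^ Suc n) f p q r u t = h2 *\<^sub>U s p (s u ((b3 ^^ n) f (p - 1) q r (u - 1) (Suc t)))"
      by (simp add: b3_def)
    then show ?case by (simp add: Suc mult_ac)
  }
qed simp_all

text \<open>Both \<open>b2\<close> and \<open>b3\<close> lower \<open>p\<close>, hence two chained
  falling factorials in \<open>p\<close>; \<open>ffact_add\<close> merges such products in the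
  comparison of coefficients.\<close>

lemma b_pow_mon:
  "mult_pow b n (M p q r u t) = (\<Sum>\<epsilon>\<le>n. \<Sum>\<zeta>\<le>n - \<epsilon>. s ((n choose \<epsilon>) * ((n - \<epsilon>) choose \<zeta>))
     ((- 1) ^ \<zeta> *\<^sub>U h2 ^ (n - \<epsilon> - \<zeta>) *\<^sub>U s (ffact p \<zeta> * ffact (p - \<zeta>) (n - \<epsilon> - \<zeta>)) (s (ffact u (n - \<epsilon> - \<zeta>))
       (M (p - \<zeta> - (n - \<epsilon> - \<zeta>)) (q + \<epsilon>) (r + \<zeta>) (u - (n - \<epsilon> - \<zeta>)) (t + (n - \<epsilon> - \<zeta>))))))"
proof -
  have additive: "additive b1" "additive b2" "additive b3"
    by (auto simp: additive_def fun_eq_iff b1_def b2_def b3_def lin_simps)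
  have commute: "b2 (b3 f) = b3 (b2 f)" "b1 (b2 f + b3 f) = b2 (b1 f) + b3 (b1 f)" for f
    by (auto simp: fun_eq_iff b1_def b2_def b3_def mult_ac)
  let ?f = "\<lambda>n p q r u t. mult_pow b n (M p q r u t)"
  have step: "?f (Suc n) = b1 (?f n) + (b2 (?f n) + b3 (?f n))" for n
    unfolding funpow_Suc_right comp_apply
    by (intro ext) (simp add: b1_def b2_def b3_def actions mult_pow_add mult_pow_diff funpow_scale)
  have "?f n = ((\<lambda>f. b1 f + (b2 f + b3 f)) ^^ n) M"
  proof (induction n)
    case (Suc n)
    show ?case using step[of n] by (simp only: Suc.IH funpow.simps comp_apply)
  qed simp
  also have "\<dots> = (\<Sum>\<eta>\<le>n. nsmul (n choose \<eta>) ((b1 ^^ \<eta>) (((\<lambda>f. b2 f + b3 f) ^^ (n - \<eta>)) M)))"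
    by (rule binomial_funpow[OF additive(1) additive_plus[OF additive(2,3)], OF commute(2)])
  also have "\<dots> = (\<Sum>\<eta>\<le>n. nsmul (n choose \<eta>) ((b1 ^^ \<eta>) (\<Sum>\<theta>\<le>n - \<eta>. nsmul ((n - \<eta>) choose \<theta>)
      ((b2 ^^ \<theta>) ((b3 ^^ (n - \<eta> - \<theta>)) M)))))"
    by (simp only: binomial_funpow[OF additive(2,3), OF commute(1)])
  finally have "?f n = \<dots>" .
  from this[THEN fun_cong, THEN fun_cong, THEN fun_cong, THEN fun_cong, THEN fun_cong, of p q r u t]
  show ?thesis
    by (simp add: nsmul_fun nsmul_UM sum_fun_apply b_funpow UM.scale_sum_right mult_ac)
qed

text \<open>\<open>X\<close> and \<open>Y\<close> act on the right monomial first and give its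
  lowered exponents \<open>p - \<mu>\<close> and \<open>q - (\<gamma> - \<delta>)\<close>; the
  powers of \<open>d\<close>, \<open>b\<close> and \<open>Z\<close> are left to be normally
  ordered.\<close>

lemma mult_mon_expand:
  "M i j k l m * M p q r u t = (\<Sum>\<beta>\<le>i. \<Sum>\<gamma>\<le>\<beta>. \<Sum>\<delta>\<le>\<gamma>. \<Sum>\<mu>\<le>j - \<delta> - (\<beta> - \<gamma>).
    (of_nat ((i choose \<beta>) * (\<beta> choose \<gamma>) * (\<gamma> choose \<delta>) * ffact j \<delta> * ffact l (\<gamma> - \<delta>) * ffact (j - \<delta>) (\<beta> - \<gamma>)
      * ffact (l - (\<gamma> - \<delta>)) (\<beta> - \<gamma>) * ((j - \<delta> - (\<beta> - \<gamma>)) choose \<mu>) * ffact (l - (\<gamma> - \<delta>) - (\<beta> - \<gamma>)) \<mu>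
      * ffact q (\<gamma> - \<delta>) * ffact p \<mu>) * (h ^ \<delta> * (- h) ^ (\<gamma> - \<delta>) * (- h) ^ (\<beta> - \<gamma>) * h ^ \<mu>))
    *\<^sub>U (Z ^^ \<delta>) (mult_pow e (\<beta> - \<gamma>) (mult_pow a (i - \<beta>)
      (mult_pow b (j - \<delta> - (\<beta> - \<gamma>) - \<mu>) (mult_pow c k (mult_pow d (l - (\<gamma> - \<delta>) - (\<beta> - \<gamma>) - \<mu>)
        (M (p - \<mu>) (q - (\<gamma> - \<delta>)) r u (t + (\<gamma> - \<delta>) + \<mu> + m))))))))"
  by (subst mult_a_eq) (simp add: aZ_funpow aY_funpow aE_funpow aA_funpow mult_b_eq mult_pow_sum Z_pow_sum
    UM.scale_sum_right funpow_scale pow_mon mult_ac add_ac)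

end

section \<open>Comparison of coefficients\<close>

lemma ffact_eq_0: "n < k \<Longrightarrow> ffact n k = 0"
proof (induction k arbitrary: n)
  case (Suc k)
  then show ?case by (cases n) auto
qed simp

lemma ffact_fact: "k \<le> n \<Longrightarrow> ffact n k * fact (n - k) = fact n"
proof (induction k arbitrary: n)
  case (Suc k)
  then obtain n' where "n = Suc n'" by (cases n) auto
  then show ?case using Suc by (simp add: mult.assoc del: mult_Suc)
qed simp

lemma ffact_fact_real: "k \<le> n \<Longrightarrow> real (ffact n k) = fact n / fact (n - k)"
  using ffact_fact[of k n] by (metis fact_nonzero nonzero_eq_divide_eq of_nat_fact of_nat_mult)

lemma falling_eq_ffact: "falling (int n) (int k) = int (ffact n k)"
proof (induction k)
  case (Suc k)
  have "{0..<int (Suc k)} = insert (int k) {0..<int k}" by auto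
  then have "falling (int n) (int (Suc k)) = (int n - int k) * falling (int n) (int k)"
    by (simp add: falling_def)
  then show ?case
    using Suc by (cases "k \<le> n") (simp_all add: ffact_Suc_right ffact_eq_0 of_nat_diff del: ffact.simps(2))
qed (simp add: falling_def)

text \<open>Vandermonde's identity for falling factorials. It produces the innermost sum of the
  formula: of \<open>k\<close> derivatives in d, \<open>x\<close> hit the \<open>n\<close> letters
  newly supplied by the left factor.\<close>

lemma ffact_vandermonde:
  "ffact (u + n) k = (\<Sum>x\<le>n. (k choose x) * (n choose x) * fact x * ffact u (k - x))"
proof -
  have ffact: "ffact m k = fact k * (m choose k)" for m k
  proof (cases "k \<le> m")
    case True
    have "ffact m k * fact (m - k) = fact k * (m choose k) * fact (m - k)"
      using ffact_fact[OF True] binomial_fact_lemma[OF True] by (simp only: mult_ac)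
    then show ?thesis by simp
  qed (simp add: ffact_eq_0 binomial_eq_0)
  have "ffact (u + n) k = (\<Sum>x\<le>k. fact k * ((n choose x) * (u choose (k - x))))"
    using vandermonde[of n u k] by (simp add: ffact add.commute flip: sum_distrib_left)
  also have "\<dots> = (\<Sum>x\<le>k. (k choose x) * (n choose x) * fact x * ffact u (k - x))"
  proof (rule sum.cong)
    fix x assume "x \<in> {..k}"
    then have "fact x * fact (k - x) * (k choose x) = (fact k :: nat)"
      by (intro binomial_fact_lemma) simp
    then show "fact k * ((n choose x) * (u choose (k - x))) = (k choose x) * (n choose x) * fact x * ffact u (k - x)"
      by (simp add: ffact mult_ac flip: \<open>_ = fact k\<close>)
  qed simp
  also have "\<dots> = (\<Sum>x\<in>{..k} \<inter> {..n}. (k choose x) * (n choose x) * fact x * ffact u (k - x))"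
    by (rule sum.mono_neutral_right) (auto simp: binomial_eq_0)
  also have "\<dots> = (\<Sum>x\<le>n. (k choose x) * (n choose x) * fact x * ffact u (k - x))"
    by (rule sum.mono_neutral_left) (auto simp: binomial_eq_0)
  finally show ?thesis .
qed

lemma multinom_binomial: "multinom (int n) [int k] = n choose k"
  by (cases "k \<le> n") (auto simp: multinom_def binomial_fact' of_nat_diff nat_diff_distrib' mult.commute)

lemma multinom_eq_0:
  "multinom n ks = 0" if "sum_list ks > n \<or> (\<exists>k\<in>set ks. k < 0)"
  using that by (auto simp: multinom_def)

text \<open>The division in \<open>multinom\<close> is exact because the multinomial coefficient is
  a product of binomial coefficients, here \<open>?B\<close>.\<close>

lemma multinom4:
  "real (multinom (int (a + b + c + d + e)) [int a, int b, int c, int d])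
    = fact (a + b + c + d + e) / (fact a * fact b * fact c * fact d * fact e)"
proof -
  let ?n = "a + b + c + d + e"
  let ?B = "(?n choose a) * ((b + c + d + e) choose b) * ((c + d + e) choose c) * ((d + e) choose d)"
  have *: "fact (x + y) = fact x * (fact y * (x + y choose x))" for x y :: nat
    using binomial_fact_lemma[of x "x + y"] by (simp add: mult.assoc)
  have "fact ?n = (fact a * fact b * fact c * fact d * fact e) * ?B"
    using *[of a "b + c + d + e"] *[of b "c + d + e"] *[of c "d + e"] *[of d e]
    by (simp only: add.assoc mult_ac)
  then have "real (fact ?n div (fact a * fact b * fact c * fact d * fact e))
     = real (fact ?n) / real (fact a * fact b * fact c * fact d * fact e)"
    by (intro real_of_nat_div) simp
  moreover have "multinom (int ?n) [int a, int b, int c, int d] = fact ?n div (fact a * fact b * fact c * fact d * fact e)"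
    by (simp add: multinom_def mult.assoc nat_add_distrib)
  ultimately show ?thesis by simp
qed

lemma binomial_real: "k \<le> n \<Longrightarrow> real (n choose k) = fact n / (fact k * fact (n - k))"
  by (simp add: binomial_fact)

text \<open>With all multiplicities as independent natural numbers, both sides are the same quotient
  of factorials. They are compared in the reals, since factorials may vanish in a field of positive
  characteristic.\<close>

lemma coefficient_identity:
  fixes i0 \<delta> \<gamma>' \<nu> \<mu> \<epsilon> \<zeta> \<zeta>' \<eta> \<theta> \<theta>' :: nat
  defines "\<alpha> \<equiv> \<nu> + \<mu>" and "\<gamma> \<equiv> \<delta> + \<gamma>'"
  defines "\<beta> \<equiv> \<gamma> + \<nu>"
  defines "i \<equiv> \<beta> + i0" and "j \<equiv> \<alpha> + \<delta> + \<epsilon> + \<zeta> + \<zeta>'" and "l \<equiv> \<alpha> + \<gamma>' + \<eta> + \<theta> + \<theta>'"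
  shows "(i choose \<beta>) * (\<beta> choose \<gamma>) * (\<gamma> choose \<delta>) * ffact j \<delta> * ffact l \<gamma>' * ffact (j - \<delta>) \<nu> * ffact (l - \<gamma>') \<nu>
      * ((j - \<delta> - \<nu>) choose \<mu>) * ffact (l - \<gamma>' - \<nu>) \<mu>
      * ((j - \<alpha> - \<delta>) choose \<epsilon>) * ((\<zeta> + \<zeta>') choose \<zeta>) * ((l - \<alpha> - \<gamma>') choose \<eta>) * ((\<theta> + \<theta>') choose \<theta>)
    = fact \<alpha> * fact \<beta> * multinom (int \<alpha>) [int \<nu>] * multinom (int i) [int \<beta>]
      * multinom (int j) [int \<alpha>, int \<delta>, int \<epsilon>, int \<zeta>] * multinom (int l) [int \<alpha>, int \<gamma>', int \<eta>, int \<theta>]"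
    (is "?L = ?R")
proof -
  have "real ?L = real ?R"
    unfolding of_nat_mult multinom_binomial i_def j_def l_def multinom4
    unfolding \<beta>_def \<gamma>_def \<alpha>_def
    by (simp add: ffact_fact_real binomial_real field_simps)
  then show ?thesis by (simp only: of_nat_eq_iff)
qed

context inv6
begin

lemma inner_expand:
  "(Z ^^ \<delta>) (mult_pow e \<nu> (mult_pow a n (mult_pow b J (mult_pow c k (mult_pow d L (M p q r u t)))))) =
    (\<Sum>\<epsilon>\<le>J. \<Sum>\<zeta>\<le>J - \<epsilon>. \<Sum>\<eta>\<le>L. \<Sum>\<theta>\<le>L - \<eta>.
      (of_nat ((J choose \<epsilon>) * ((J - \<epsilon>) choose \<zeta>) * (L choose \<eta>) * ((L - \<eta>) choose \<theta>)
        * (ffact p (L - \<eta> - \<theta>) * ffact (p - (L - \<eta> - \<theta>)) \<zeta> * ffact (p - (L - \<eta> - \<theta>) - \<zeta>) (J - \<epsilon> - \<zeta>))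
        * ffact q (L - \<eta> - \<theta>) * ffact r \<theta>
        * (ffact (u + \<eta>) (J - \<epsilon> - \<zeta>) * ffact (u + \<eta> - (J - \<epsilon> - \<zeta>)) \<delta>))
       * ((- 1) ^ \<theta> * (- h2) ^ (L - \<eta> - \<theta>) * (- 1) ^ \<zeta> * h2 ^ (J - \<epsilon> - \<zeta>))) *\<^sub>U
       M (p - (L - \<eta> - \<theta>) - \<zeta> - (J - \<epsilon> - \<zeta>) + n) (q - (L - \<eta> - \<theta>) + \<epsilon>) (r - \<theta> + k + \<zeta>)
         (u + \<eta> - (J - \<epsilon> - \<zeta>) - \<delta>) (t + (L - \<eta>) + (J - \<epsilon> - \<zeta>) + \<delta> + \<nu>))"
    (is "?lhs = (\<Sum>\<epsilon>\<le>J. \<Sum>\<zeta>\<le>J - \<epsilon>. \<Sum>\<eta>\<le>L. \<Sum>\<theta>\<le>L - \<eta>. ?F \<epsilon> \<zeta> \<eta> \<theta>)")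
proof -
  have "?lhs = (\<Sum>\<eta>\<le>L. \<Sum>\<theta>\<le>L - \<eta>. \<Sum>\<epsilon>\<le>J. \<Sum>\<zeta>\<le>J - \<epsilon>. ?F \<epsilon> \<zeta> \<eta> \<theta>)"
    by (simp add: d_pow_mon b_pow_mon mult_pow_sum Z_pow_sum funpow_scale pow_mon UM.scale_sum_right mult_ac add_ac)
  \<comment> \<open>Expanding the inner power of \<open>d\<close> first puts its indices outermost;
    exchanging sums restores the stated order.\<close>
  also have "\<dots> = (\<Sum>\<epsilon>\<le>J. \<Sum>\<eta>\<le>L. \<Sum>\<zeta>\<le>J - \<epsilon>. \<Sum>\<theta>\<le>L - \<eta>. ?F \<epsilon> \<zeta> \<eta> \<theta>)"
    by (subst sum.swap[of _ "{..J}"], subst sum.swap[of _ "{..J}"]) (intro sum.cong refl sum.swap)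
  also have "\<dots> = (\<Sum>\<epsilon>\<le>J. \<Sum>\<zeta>\<le>J - \<epsilon>. \<Sum>\<eta>\<le>L. \<Sum>\<theta>\<le>L - \<eta>. ?F \<epsilon> \<zeta> \<eta> \<theta>)"
    by (intro sum.cong refl sum.swap)
  finally show ?thesis .
qed

end

section \<open>Identification with the summands of the formula\<close>

definition summand :: "int \<Rightarrow> int \<Rightarrow> int \<Rightarrow> int \<Rightarrow> int \<Rightarrow> int \<Rightarrow> int \<Rightarrow> int \<Rightarrow> int \<Rightarrow> int \<Rightarrow>
    int \<Rightarrow> int \<Rightarrow> int \<Rightarrow> int \<Rightarrow> int \<Rightarrow> int \<Rightarrow> int \<Rightarrow> int \<Rightarrow> int \<Rightarrow> 'f::field UM" where
  "summand i j k l m p q r s t \<alpha> \<beta> \<gamma> \<delta> \<epsilon> \<zeta> \<eta> \<theta> \<kappa> =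
      ((- 1) powi (\<beta> + \<zeta> + l - \<alpha> - \<gamma> - \<eta>)
       * (of_nat (fact (nat \<alpha>) * fact (nat \<beta>) * fact (nat \<kappa>))
          / (2 powi (\<alpha> + \<gamma>) * 3 powi (j - \<epsilon> - \<zeta> + l - \<alpha> - \<eta> - \<theta>)))
       * of_nat (multinom \<alpha> [\<beta> - \<gamma>] * multinom i [\<beta>] * multinom j [\<alpha>, \<delta>, \<epsilon>, \<zeta>]
          * multinom (j - \<alpha> - \<epsilon> - \<zeta>) [\<kappa>] * multinom l [\<alpha>, \<gamma> - \<delta>, \<eta>, \<theta>] * multinom \<eta> [\<kappa>])
       * of_int (falling p (j - \<beta> - \<epsilon> + l - \<alpha> - \<eta> - \<theta>) * falling q (l - \<alpha> - \<eta> - \<theta>)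
          * falling r \<theta> * falling s (j - \<alpha> - \<epsilon> - \<zeta> - \<kappa>)))
      *\<^sub>U UM_monom (i + p - j + \<epsilon> - l + \<alpha> + \<eta> + \<theta>) (\<epsilon> + q - l + \<alpha> + \<eta> + \<theta>)
           (\<zeta> + k + r - \<theta>) (\<eta> + s + \<alpha> + \<epsilon> + \<zeta> - j)
           (j - \<alpha> - \<epsilon> - \<zeta> + l - \<eta> + m + t)"

lemma sum_int_nat: "(\<Sum>x=0..int n. f x) = (\<Sum>x\<le>n. f (int x))"
proof -
  have "{0..int n} = int ` {..n}"
    using image_int_atLeastAtMost[of 0 n] by (simp add: atMost_atLeast0)
  then show ?thesis by (simp add: sum.reindex)
qed

context inv6
begin

text \<open>Each \<open>h\<close> contributes 1/2 and 1/3, each \<open>h2\<close> only 1/3; the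
  signs come from \<open>aE\<close>, \<open>aY\<close>, \<open>b2\<close>, \<open>d2\<close> and
  \<open>d3\<close>.\<close>

lemma scalar_identity:
  "(- 1) ^ (\<nu> + \<zeta> + \<gamma>' + \<theta> + \<theta>') / (2 ^ (\<nu> + \<mu> + \<delta> + \<gamma>') * 3 ^ (\<nu> + \<mu> + \<delta> + \<gamma>' + \<zeta>' + \<theta>'))
   = h ^ \<delta> * (- h) ^ \<gamma>' * (- h) ^ \<nu> * h ^ \<mu> * ((- 1) ^ \<theta> * (- h2) ^ \<theta>' * (- 1) ^ \<zeta> * h2 ^ \<zeta>')"
proof -
  define g w :: 'f where "g = inverse 2" and "w = inverse 3"
  have *: "2 * (3 * h) = 1" "3 * (2 * h) = 1"
    using h6 by (simp_all flip: mult.assoc)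
  have gw: "g = 3 * h" "w = 2 * h"
    using inverse_unique[OF *(1)] inverse_unique[OF *(2)] by (simp_all add: g_def w_def)
  have "g * w = (6 * h) * h"
    by (simp add: gw)
  then have h: "h = g * w" "h2 = w"
    by (simp_all add: h6 h2_def gw)
  have "(- 1) ^ (\<nu> + \<zeta> + \<gamma>' + \<theta> + \<theta>') / (2 ^ (\<nu> + \<mu> + \<delta> + \<gamma>') * 3 ^ (\<nu> + \<mu> + \<delta> + \<gamma>' + \<zeta>' + \<theta>'))
    = (- 1) ^ (\<nu> + \<zeta> + \<gamma>' + \<theta> + \<theta>') * (g ^ (\<nu> + \<mu> + \<delta> + \<gamma>') * w ^ (\<nu> + \<mu> + \<delta> + \<gamma>' + \<zeta>' + \<theta>'))"
    by (simp only: g_def w_def divide_inverse inverse_mult_distrib power_inverse)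
  also have "\<dots> = h ^ \<delta> * (- h) ^ \<gamma>' * (- h) ^ \<nu> * h ^ \<mu> * ((- 1) ^ \<theta> * (- h2) ^ \<theta>' * (- 1) ^ \<zeta> * h2 ^ \<zeta>')"
    unfolding power_minus[of h] power_minus[of h2] unfolding h(2) unfolding h(1) by (simp add: power_add power_mult_distrib mult_ac)
  finally show ?thesis .
qed

text \<open>Only four factors of the summand depend on \<kappa>, and
  \<open>ffact_vandermonde\<close> sums their products. \<open>\<zeta>'\<close> and
  \<open>\<theta>'\<close> are the complementary parts left implicit in the multinomial
  coefficients.\<close>

lemma summand_sum:
  fixes n \<delta> \<gamma>' \<nu> \<mu> \<epsilon> \<zeta> \<zeta>' \<eta> \<theta> \<theta>' k m p q r u t :: nat
  defines "\<alpha> \<equiv> \<nu> + \<mu>" and "\<gamma> \<equiv> \<delta> + \<gamma>'"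
  defines "\<beta> \<equiv> \<gamma> + \<nu>"
  defines "i \<equiv> \<beta> + n" and "j \<equiv> \<alpha> + \<delta> + \<epsilon> + \<zeta> + \<zeta>'" and "l \<equiv> \<alpha> + \<gamma>' + \<eta> + \<theta> + \<theta>'"
  shows "(\<Sum>\<kappa>=0..int \<eta>. summand (int i) (int j) (int k) (int l) (int m) (int p) (int q) (int r) (int u) (int t)
      (int \<alpha>) (int \<beta>) (int \<gamma>) (int \<delta>) (int \<epsilon>) (int \<zeta>) (int \<eta>) (int \<theta>) \<kappa>)
    = (of_nat (((i choose \<beta>) * (\<beta> choose \<gamma>) * (\<gamma> choose \<delta>) * ffact j \<delta> * ffact l \<gamma>' * ffact (j - \<delta>) \<nu> * ffact (l - \<gamma>') \<nu>
      * ((j - \<delta> - \<nu>) choose \<mu>) * ffact (l - \<gamma>' - \<nu>) \<mu>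
      * ((j - \<alpha> - \<delta>) choose \<epsilon>) * ((\<zeta> + \<zeta>') choose \<zeta>) * ((l - \<alpha> - \<gamma>') choose \<eta>) * ((\<theta> + \<theta>') choose \<theta>))
      * (ffact p (\<mu> + \<theta>' + \<zeta> + \<zeta>') * ffact q (\<gamma>' + \<theta>') * ffact r \<theta> * ffact (u + \<eta>) (\<zeta>' + \<delta>)))
     * (h ^ \<delta> * (- h) ^ \<gamma>' * (- h) ^ \<nu> * h ^ \<mu> * ((- 1) ^ \<theta> * (- h2) ^ \<theta>' * (- 1) ^ \<zeta> * h2 ^ \<zeta>')))
     *\<^sub>U M (n + (p - (\<mu> + \<theta>' + \<zeta> + \<zeta>'))) (q - (\<gamma>' + \<theta>') + \<epsilon>) (r - \<theta> + k + \<zeta>) (u + \<eta> - (\<zeta>' + \<delta>))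
        (t + \<gamma>' + \<mu> + m + \<theta> + \<theta>' + \<zeta>' + \<delta> + \<nu>)"
    (is "?S = (of_nat (?K * ?F) * ?c) *\<^sub>U ?M")
proof -
  let ?P = "ffact p (\<mu> + \<theta>' + \<zeta> + \<zeta>') * ffact q (\<gamma>' + \<theta>') * ffact r \<theta>"
  let ?N = "UM_monom (int i + int p - int j + int \<epsilon> - int l + int \<alpha> + int \<eta> + int \<theta>)
    (int \<epsilon> + int q - int l + int \<alpha> + int \<eta> + int \<theta>) (int \<zeta> + int k + int r - int \<theta>)
    (int \<eta> + int u + int \<alpha> + int \<epsilon> + int \<zeta> - int j) (int j - int \<alpha> - int \<epsilon> - int \<zeta> + int l - int \<eta> + int m + int t) :: 'f UM"
  have diffs: "int \<beta> + int \<zeta> + int l - int \<alpha> - int \<gamma> - int \<eta> = int (\<nu> + \<zeta> + \<gamma>' + \<theta> + \<theta>')"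
    "int \<alpha> + int \<gamma> = int (\<nu> + \<mu> + \<delta> + \<gamma>')"
    "int j - int \<epsilon> - int \<zeta> + int l - int \<alpha> - int \<eta> - int \<theta> = int (\<nu> + \<mu> + \<delta> + \<gamma>' + \<zeta>' + \<theta>')"
    "int \<beta> - int \<gamma> = int \<nu>" "int \<gamma> - int \<delta> = int \<gamma>'" "int j - int \<alpha> - int \<epsilon> - int \<zeta> = int (\<zeta>' + \<delta>)"
    "int j - int \<beta> - int \<epsilon> + int l - int \<alpha> - int \<eta> - int \<theta> = int (\<mu> + \<theta>' + \<zeta> + \<zeta>')"
    "int l - int \<alpha> - int \<eta> - int \<theta> = int (\<gamma>' + \<theta>')"
    by (simp_all add: i_def j_def l_def \<alpha>_def \<beta>_def \<gamma>_def)
  define K where "K = ?K"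
  have K: "of_nat K = (of_nat (fact \<alpha>) * of_nat (fact \<beta>) * of_nat (multinom (int \<alpha>) [int \<nu>]) * of_nat (multinom (int i) [int \<beta>])
      * of_nat (multinom (int j) [int \<alpha>, int \<delta>, int \<epsilon>, int \<zeta>]) * of_nat (multinom (int l) [int \<alpha>, int \<gamma>', int \<eta>, int \<theta>]) :: 'f)"
    unfolding K_def i_def j_def l_def \<alpha>_def \<beta>_def \<gamma>_def coefficient_identity of_nat_mult ..
  have "?S = (\<Sum>\<kappa>\<le>\<eta>. (of_nat (K * ?P) * ?c * of_nat (((\<zeta>' + \<delta>) choose \<kappa>) * (\<eta> choose \<kappa>) * fact \<kappa> * ffact u (\<zeta>' + \<delta> - \<kappa>))) *\<^sub>U ?N)"
    unfolding sum_int_nat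
  proof (rule sum.cong[OF refl])
    fix \<kappa> assume "\<kappa> \<in> {..\<eta>}"
    note unfolds = summand_def diffs scalar_identity[symmetric] power_int_of_nat falling_eq_ffact nat_int
      multinom_binomial[of "\<zeta>' + \<delta>"] multinom_binomial[of \<eta>]
    show "summand (int i) (int j) (int k) (int l) (int m) (int p) (int q) (int r) (int u) (int t)
      (int \<alpha>) (int \<beta>) (int \<gamma>) (int \<delta>) (int \<epsilon>) (int \<zeta>) (int \<eta>) (int \<theta>) (int \<kappa>)
      = (of_nat (K * ?P) * ?c * of_nat (((\<zeta>' + \<delta>) choose \<kappa>) * (\<eta> choose \<kappa>) * fact \<kappa> * ffact u (\<zeta>' + \<delta> - \<kappa>))) *\<^sub>U ?N"
    \<comment> \<open>Beyond this bound the last falling factorial has a negative length, but both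
      sides carry a vanishing binomial coefficient.\<close>
    proof (cases "\<kappa> \<le> \<zeta>' + \<delta>")
      case True
      then have *: "int (\<zeta>' + \<delta>) - int \<kappa> = int (\<zeta>' + \<delta> - \<kappa>)"
        by simp
      show ?thesis
        unfolding unfolds * of_nat_mult of_int_mult of_int_of_nat_eq K
        by (rule arg_cong[where f = "\<lambda>x. x *\<^sub>U _"]) (simp only: divide_inverse mult_ac)
    qed (simp add: unfolds binomial_eq_0 del: of_nat_add)
  qed
  also have "\<dots> = (of_nat (K * ?P) * ?c * of_nat (ffact (u + \<eta>) (\<zeta>' + \<delta>))) *\<^sub>U ?N"
    unfolding ffact_vandermonde of_nat_sum sum_distrib_left UM.scale_sum_left ..
  also have "\<dots> = (of_nat (?K * ?F) * ?c) *\<^sub>U ?N"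
    unfolding K_def by (simp add: mult_ac)
  also have "\<dots> = (of_nat (?K * ?F) * ?c) *\<^sub>U ?M"
  \<comment> \<open>If no falling factorial vanishes, the integer exponents are nonnegative and
    agree with the truncated ones; otherwise they may differ, but the coefficient is 0.\<close>
  proof (cases "?F = 0")
    case False
    then have "\<mu> + \<theta>' + \<zeta> + \<zeta>' \<le> p" "\<gamma>' + \<theta>' \<le> q" "\<theta> \<le> r" "\<zeta>' + \<delta> \<le> u + \<eta>"
      using ffact_eq_0 by (metis mult_zero_left mult_zero_right not_le)+
    then have idx: "int i + int p - int j + int \<epsilon> - int l + int \<alpha> + int \<eta> + int \<theta> = int (n + (p - (\<mu> + \<theta>' + \<zeta> + \<zeta>')))"
      "int \<epsilon> + int q - int l + int \<alpha> + int \<eta> + int \<theta> = int (q - (\<gamma>' + \<theta>') + \<epsilon>)"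
      "int \<zeta> + int k + int r - int \<theta> = int (r - \<theta> + k + \<zeta>)"
      "int \<eta> + int u + int \<alpha> + int \<epsilon> + int \<zeta> - int j = int (u + \<eta> - (\<zeta>' + \<delta>))"
      "int j - int \<alpha> - int \<epsilon> - int \<zeta> + int l - int \<eta> + int m + int t
        = int (t + \<gamma>' + \<mu> + m + \<theta> + \<theta>' + \<zeta>' + \<delta> + \<nu>)"
      by (simp_all add: i_def j_def l_def \<alpha>_def \<beta>_def \<gamma>_def of_nat_diff)
    have "?N = ?M"
      unfolding idx mon_def ..
    then show ?thesis by simp
  next
    case True
    then show ?thesis by (simp only: mult_zero_right of_nat_0 mult_zero_left UM.scale_zero_left)
  qed
  finally show ?thesis .
qed

text \<open>For fixed outer indices, the inner sums are the normal ordering of one term of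
  \<open>mult_mon_expand\<close>.\<close>

lemma inner_sum:
  fixes n \<delta> \<gamma>' \<nu> \<mu> J L k m p q r u t :: nat
  defines "\<alpha> \<equiv> \<nu> + \<mu>" and "\<gamma> \<equiv> \<delta> + \<gamma>'"
  defines "\<beta> \<equiv> \<gamma> + \<nu>"
  defines "i \<equiv> \<beta> + n" and "j \<equiv> \<alpha> + \<delta> + J" and "l \<equiv> \<alpha> + \<gamma>' + L"
  shows "(\<Sum>\<epsilon>\<le>J. \<Sum>\<zeta>\<le>J - \<epsilon>. \<Sum>\<eta>\<le>L. \<Sum>\<theta>\<le>L - \<eta>. \<Sum>\<kappa>=0..int \<eta>.
      summand (int i) (int j) (int k) (int l) (int m) (int p) (int q) (int r) (int u) (int t)
      (int \<alpha>) (int \<beta>) (int \<gamma>) (int \<delta>) (int \<epsilon>) (int \<zeta>) (int \<eta>) (int \<theta>) \<kappa>)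
    = (of_nat ((i choose \<beta>) * (\<beta> choose \<gamma>) * (\<gamma> choose \<delta>) * ffact j \<delta> * ffact l \<gamma>' * ffact (j - \<delta>) \<nu> * ffact (l - \<gamma>') \<nu>
      * ((j - \<delta> - \<nu>) choose \<mu>) * ffact (l - \<gamma>' - \<nu>) \<mu> * ffact q \<gamma>' * ffact p \<mu>)
      * (h ^ \<delta> * (- h) ^ \<gamma>' * (- h) ^ \<nu> * h ^ \<mu>))
    *\<^sub>U (Z ^^ \<delta>) (mult_pow e \<nu> (mult_pow a n (mult_pow b J (mult_pow c k (mult_pow d L
        (M (p - \<mu>) (q - \<gamma>') r u (t + \<gamma>' + \<mu> + m)))))))"
    (is "_ = (of_nat ?K * ?c) *\<^sub>U _")
  unfolding inner_expand UM.scale_sum_right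
proof (intro sum.cong refl)
  fix \<epsilon> \<zeta> \<eta> \<theta> assume *: "\<epsilon> \<in> {..J}" "\<zeta> \<in> {..J - \<epsilon>}" "\<eta> \<in> {..L}" "\<theta> \<in> {..L - \<eta>}"
  define \<zeta>' \<theta>' where "\<zeta>' = J - \<epsilon> - \<zeta>" and "\<theta>' = L - \<eta> - \<theta>"
  have J: "J - \<epsilon> - \<zeta> = \<zeta>'" "J - \<epsilon> = \<zeta> + \<zeta>'" and L: "L - \<eta> - \<theta> = \<theta>'" "L - \<eta> = \<theta> + \<theta>'"
    and j: "\<alpha> + \<delta> + \<epsilon> + \<zeta> + \<zeta>' = j" and l: "\<alpha> + \<gamma>' + \<eta> + \<theta> + \<theta>' = l"
    and J': "j - \<alpha> - \<delta> = J" and L': "l - \<alpha> - \<gamma>' = L"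
    using * by (simp_all add: \<zeta>'_def \<theta>'_def j_def l_def)
  have pq: "p - \<mu> - \<theta>' - \<zeta> - \<zeta>' + n = n + (p - (\<mu> + \<theta>' + \<zeta> + \<zeta>'))"
      "q - \<gamma>' - \<theta>' = q - (\<gamma>' + \<theta>')" "u + \<eta> - \<zeta>' - \<delta> = u + \<eta> - (\<zeta>' + \<delta>)"
      "t + \<gamma>' + \<mu> + m + (\<theta> + \<theta>') + \<zeta>' + \<delta> + \<nu> = t + \<gamma>' + \<mu> + m + \<theta> + \<theta>' + \<zeta>' + \<delta> + \<nu>"
    by simp_all
  \<comment> \<open>Lowerings of the same exponent at different stages combine into one falling
    factorial.\<close>
  have ffact: "ffact p (\<mu> + \<theta>' + \<zeta> + \<zeta>') = ffact p \<mu> * (ffact (p - \<mu>) \<theta>' * ffact (p - \<mu> - \<theta>') \<zeta> * ffact (p - \<mu> - \<theta>' - \<zeta>) \<zeta>')"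
    "ffact q (\<gamma>' + \<theta>') = ffact q \<gamma>' * ffact (q - \<gamma>') \<theta>'" "ffact (u + \<eta>) (\<zeta>' + \<delta>) = ffact (u + \<eta>) \<zeta>' * ffact (u + \<eta> - \<zeta>') \<delta>"
    by (simp_all add: ffact_add)
  note sum = summand_sum[where \<nu> = \<nu> and \<mu> = \<mu> and \<delta> = \<delta> and \<gamma>' = \<gamma>' and n = n and \<epsilon> = \<epsilon> and \<zeta> = \<zeta> and \<zeta>' = \<zeta>' and \<eta> = \<eta> and \<theta> = \<theta> and \<theta>' = \<theta>' and k = k and m = m and p = p and q = q and r = r and u = u and t = t,
     folded \<alpha>_def \<gamma>_def, folded \<beta>_def, folded i_def, unfolded j l]
  show "(\<Sum>\<kappa>=0..int \<eta>. summand (int i) (int j) (int k) (int l) (int m) (int p) (int q) (int r) (int u) (int t)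
      (int \<alpha>) (int \<beta>) (int \<gamma>) (int \<delta>) (int \<epsilon>) (int \<zeta>) (int \<eta>) (int \<theta>) \<kappa>) =
     (of_nat ?K * ?c) *\<^sub>U (of_nat ((J choose \<epsilon>) * ((J - \<epsilon>) choose \<zeta>) * (L choose \<eta>) * ((L - \<eta>) choose \<theta>)
        * (ffact (p - \<mu>) (L - \<eta> - \<theta>) * ffact (p - \<mu> - (L - \<eta> - \<theta>)) \<zeta> * ffact (p - \<mu> - (L - \<eta> - \<theta>) - \<zeta>) (J - \<epsilon> - \<zeta>))
        * ffact (q - \<gamma>') (L - \<eta> - \<theta>) * ffact r \<theta>
        * (ffact (u + \<eta>) (J - \<epsilon> - \<zeta>) * ffact (u + \<eta> - (J - \<epsilon> - \<zeta>)) \<delta>))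
       * ((- 1) ^ \<theta> * (- h2) ^ (L - \<eta> - \<theta>) * (- 1) ^ \<zeta> * h2 ^ (J - \<epsilon> - \<zeta>))) *\<^sub>U
       M (p - \<mu> - (L - \<eta> - \<theta>) - \<zeta> - (J - \<epsilon> - \<zeta>) + n) (q - \<gamma>' - (L - \<eta> - \<theta>) + \<epsilon>) (r - \<theta> + k + \<zeta>)
         (u + \<eta> - (J - \<epsilon> - \<zeta>) - \<delta>) (t + \<gamma>' + \<mu> + m + (L - \<eta>) + (J - \<epsilon> - \<zeta>) + \<delta> + \<nu>)"
    unfolding sum J' L' ffact J(1) L(1) unfolding J(2) L(2) pq UM.scale_scale
    by (rule arg_cong[where f = "\<lambda>x. x *\<^sub>U _"]) (simp only: of_nat_mult mult_ac)
qed

section \<open>Change of summation index from \<mu> to \<alpha>\<close>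

lemma sum_int_diff:
  assumes "n \<le> m"
  shows "(\<Sum>x=0..int m - int n. f x) = (\<Sum>x\<le>m - n. f (int x))"
  using assms by (simp flip: of_nat_diff sum_int_nat)

lemma summand_eq_0:
  "summand i j k l m p q r u t \<alpha> \<beta> \<gamma> \<delta> \<epsilon> \<zeta> \<eta> \<theta> \<kappa> = (0 :: 'f UM)" if "\<alpha> < \<beta> - \<gamma>"
  using that by (simp add: summand_def multinom_eq_0)

lemma mult_mon_summand:
  "M i j k l m * M p q r u t = (\<Sum>\<alpha>\<le>l. \<Sum>\<beta>\<le>i. \<Sum>\<gamma>\<le>\<beta>. \<Sum>\<delta>\<le>\<gamma>.
    \<Sum>\<epsilon>=0..int j - int \<alpha> - int \<delta>. \<Sum>\<zeta>=0..int j - int \<alpha> - int \<delta> - \<epsilon>.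
    \<Sum>\<eta>=0..int l - int \<alpha> - (int \<gamma> - int \<delta>). \<Sum>\<theta>=0..int l - int \<alpha> - (int \<gamma> - int \<delta>) - \<eta>. \<Sum>\<kappa>=0..\<eta>.
      summand (int i) (int j) (int k) (int l) (int m) (int p) (int q) (int r) (int u) (int t)
      (int \<alpha>) (int \<beta>) (int \<gamma>) (int \<delta>) \<epsilon> \<zeta> \<eta> \<theta> \<kappa>)"
    (is "_ = (\<Sum>\<alpha>\<le>l. \<Sum>\<beta>\<le>i. \<Sum>\<gamma>\<le>\<beta>. \<Sum>\<delta>\<le>\<gamma>. ?G \<alpha> \<beta> \<gamma> \<delta>)")
proof -
  \<comment> \<open>\<open>\<beta> - \<gamma>\<close> counts the factors \<open>- x y u e/6\<close> and \<open>\<mu>\<close> the factors \<open>y u (e/6) \<partial>\<^sub>a\<close>, so that \<open>\<alpha> = \<beta> - \<gamma> + \<mu>\<close>.\<close>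
  define T where "T \<beta> \<gamma> \<delta> \<mu> = (of_nat ((i choose \<beta>) * (\<beta> choose \<gamma>) * (\<gamma> choose \<delta>) * ffact j \<delta> * ffact l (\<gamma> - \<delta>) * ffact (j - \<delta>) (\<beta> - \<gamma>)
      * ffact (l - (\<gamma> - \<delta>)) (\<beta> - \<gamma>) * ((j - \<delta> - (\<beta> - \<gamma>)) choose \<mu>) * ffact (l - (\<gamma> - \<delta>) - (\<beta> - \<gamma>)) \<mu>
      * ffact q (\<gamma> - \<delta>) * ffact p \<mu>) * (h ^ \<delta> * (- h) ^ (\<gamma> - \<delta>) * (- h) ^ (\<beta> - \<gamma>) * h ^ \<mu>))
    *\<^sub>U (Z ^^ \<delta>) (mult_pow e (\<beta> - \<gamma>) (mult_pow a (i - \<beta>)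
      (mult_pow b (j - \<delta> - (\<beta> - \<gamma>) - \<mu>) (mult_pow c k (mult_pow d (l - (\<gamma> - \<delta>) - (\<beta> - \<gamma>) - \<mu>)
        (M (p - \<mu>) (q - (\<gamma> - \<delta>)) r u (t + (\<gamma> - \<delta>) + \<mu> + m)))))))" for \<beta> \<gamma> \<delta> \<mu>
  have *: "(\<Sum>\<mu>\<le>j - \<delta> - (\<beta> - \<gamma>). T \<beta> \<gamma> \<delta> \<mu>) = (\<Sum>\<alpha>\<le>l. ?G \<alpha> \<beta> \<gamma> \<delta>)" if "\<beta> \<le> i" "\<gamma> \<le> \<beta>" "\<delta> \<le> \<gamma>" for \<beta> \<gamma> \<delta>
  proof -
    \<comment> \<open>These are the \<alpha> for which
      \<open>\<mu> = \<alpha> - (\<beta> - \<gamma>)\<close>, \<open>J\<close> and \<open>L\<close>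
      are honest differences. For the others a binomial coefficient vanishes or a sum is
      empty.\<close>
    let ?good = "\<lambda>\<alpha>. \<beta> - \<gamma> \<le> \<alpha> \<and> \<alpha> + \<delta> \<le> j \<and> \<alpha> + (\<gamma> - \<delta>) \<le> l"
    have good: "?G \<alpha> \<beta> \<gamma> \<delta> = T \<beta> \<gamma> \<delta> (\<alpha> - (\<beta> - \<gamma>))" if "?good \<alpha>" for \<alpha>
    proof -
      define \<nu> \<mu> \<gamma>' where "\<nu> = \<beta> - \<gamma>" and "\<mu> = \<alpha> - (\<beta> - \<gamma>)" and "\<gamma>' = \<gamma> - \<delta>"
      define J L where "J = j - \<alpha> - \<delta>" and "L = l - \<alpha> - (\<gamma> - \<delta>)"
      have eqs: "\<nu> + \<mu> = \<alpha>" "\<delta> + \<gamma>' = \<gamma>" "\<gamma> + \<nu> = \<beta>" "\<beta> + (i - \<beta>) = i" "\<alpha> + \<delta> + J = j" "\<alpha> + \<gamma>' + L = l"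
        and JL: "j - \<delta> - \<nu> - \<mu> = J" "l - \<gamma>' - \<nu> - \<mu> = L"
        using that \<open>\<beta> \<le> i\<close> \<open>\<gamma> \<le> \<beta>\<close> \<open>\<delta> \<le> \<gamma>\<close> by (auto simp: \<nu>_def \<mu>_def \<gamma>'_def J_def L_def)
      have int: "int j - int \<alpha> - int \<delta> = int J" "int l - int \<alpha> - (int \<gamma> - int \<delta>) = int L"
        using that \<open>\<delta> \<le> \<gamma>\<close> by (auto simp: J_def L_def of_nat_diff)
      have "?G \<alpha> \<beta> \<gamma> \<delta> = (\<Sum>\<epsilon>\<le>J. \<Sum>\<zeta>\<le>J - \<epsilon>. \<Sum>\<eta>\<le>L. \<Sum>\<theta>\<le>L - \<eta>. \<Sum>\<kappa>=0..int \<eta>.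
        summand (int i) (int j) (int k) (int l) (int m) (int p) (int q) (int r) (int u) (int t)
        (int \<alpha>) (int \<beta>) (int \<gamma>) (int \<delta>) (int \<epsilon>) (int \<zeta>) (int \<eta>) (int \<theta>) \<kappa>)"
        unfolding int sum_int_nat[of _ J] sum_int_nat[of _ L]
        by (intro sum.cong refl) (simp add: sum_int_diff cong: sum.cong_simp)
      also have "\<dots> = T \<beta> \<gamma> \<delta> (\<alpha> - (\<beta> - \<gamma>))"
        unfolding inner_sum[where \<nu> = \<nu> and \<mu> = \<mu> and \<delta> = \<delta> and \<gamma>' = \<gamma>' and n = "i - \<beta>" and J = J and L = L and k = k and m = m and p = p and q = q and r = r and u = u and t = t, unfolded eqs]
        unfolding T_def \<mu>_def[symmetric] unfolding \<nu>_def[symmetric] \<gamma>'_def[symmetric] JL ..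
      finally show ?thesis .
    qed
    have bad: "?G \<alpha> \<beta> \<gamma> \<delta> = 0" if "\<not> ?good \<alpha>" for \<alpha>
    proof -
      consider "int \<alpha> < int \<beta> - int \<gamma>" | "int j - int \<alpha> - int \<delta> < 0" | "int l - int \<alpha> - (int \<gamma> - int \<delta>) < 0"
        using \<open>\<not> ?good \<alpha>\<close> \<open>\<gamma> \<le> \<beta>\<close> \<open>\<delta> \<le> \<gamma>\<close> by linarith
      then show ?thesis
        by cases (simp_all add: summand_eq_0)
    qed
    \<comment> \<open>The range of \<mu> ignores \<open>l\<close>, and by truncation it keeps
      \<open>\<mu> = 0\<close> when \<open>j\<close> is too small; a falling factorial removes these
      terms.\<close>
    have zero: "T \<beta> \<gamma> \<delta> \<mu> = 0" if "\<not> (\<delta> + (\<beta> - \<gamma>) + \<mu> \<le> j \<and> (\<beta> - \<gamma>) + (\<gamma> - \<delta>) + \<mu> \<le> l)" for \<mu>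
    proof -
      have "ffact j \<delta> * ffact (j - \<delta>) (\<beta> - \<gamma>) * ((j - \<delta> - (\<beta> - \<gamma>)) choose \<mu>) = 0 \<or>
        ffact l (\<gamma> - \<delta>) * ffact (l - (\<gamma> - \<delta>)) (\<beta> - \<gamma>) * ffact (l - (\<gamma> - \<delta>) - (\<beta> - \<gamma>)) \<mu> = 0"
        using that ffact_eq_0[of j \<delta>] ffact_eq_0[of "j - \<delta>" "\<beta> - \<gamma>"] binomial_eq_0[of "j - \<delta> - (\<beta> - \<gamma>)" \<mu>]
          ffact_eq_0[of l "\<gamma> - \<delta>"] ffact_eq_0[of "l - (\<gamma> - \<delta>)" "\<beta> - \<gamma>"] ffact_eq_0[of "l - (\<gamma> - \<delta>) - (\<beta> - \<gamma>)" \<mu>]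
        unfolding mult_eq_0_iff by linarith
      then have 0: "(i choose \<beta>) * (\<beta> choose \<gamma>) * (\<gamma> choose \<delta>) * ffact j \<delta> * ffact l (\<gamma> - \<delta>) * ffact (j - \<delta>) (\<beta> - \<gamma>)
        * ffact (l - (\<gamma> - \<delta>)) (\<beta> - \<gamma>) * ((j - \<delta> - (\<beta> - \<gamma>)) choose \<mu>) * ffact (l - (\<gamma> - \<delta>) - (\<beta> - \<gamma>)) \<mu>
        * ffact q (\<gamma> - \<delta>) * ffact p \<mu> = 0"
        unfolding mult_eq_0_iff by (elim disjE) simp_all
      show ?thesis unfolding T_def 0 by simp
    qed
    define g where "g \<alpha> = ?G \<alpha> \<beta> \<gamma> \<delta>" for \<alpha>
    have "(\<Sum>\<mu>\<le>j - \<delta> - (\<beta> - \<gamma>). T \<beta> \<gamma> \<delta> \<mu>) =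
      (\<Sum>\<mu> | \<delta> + (\<beta> - \<gamma>) + \<mu> \<le> j \<and> (\<beta> - \<gamma>) + (\<gamma> - \<delta>) + \<mu> \<le> l. T \<beta> \<gamma> \<delta> \<mu>)"
      by (rule sum.mono_neutral_right) (auto simp: zero)
    also have "\<dots> = (\<Sum>\<alpha> | ?good \<alpha>. g \<alpha>)"
      by (rule sum.reindex_bij_witness[of _ "\<lambda>\<alpha>. \<alpha> - (\<beta> - \<gamma>)" "\<lambda>\<mu>. \<mu> + (\<beta> - \<gamma>)"])
        (auto simp: good[folded g_def])
    also have "\<dots> = (\<Sum>\<alpha>\<le>l. g \<alpha>)"
      by (rule sum.mono_neutral_left) (use bad[folded g_def] in auto)
    finally show ?thesis unfolding g_def .
  qed
  have "M i j k l m * M p q r u t = (\<Sum>\<beta>\<le>i. \<Sum>\<gamma>\<le>\<beta>. \<Sum>\<delta>\<le>\<gamma>. \<Sum>\<mu>\<le>j - \<delta> - (\<beta> - \<gamma>). T \<beta> \<gamma> \<delta> \<mu>)"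
    unfolding mult_mon_expand T_def ..
  also have "\<dots> = (\<Sum>\<beta>\<le>i. \<Sum>\<gamma>\<le>\<beta>. \<Sum>\<delta>\<le>\<gamma>. \<Sum>\<alpha>\<le>l. ?G \<alpha> \<beta> \<gamma> \<delta>)"
    by (intro sum.cong refl *) auto
  also have "\<dots> = (\<Sum>\<alpha>\<le>l. \<Sum>\<beta>\<le>i. \<Sum>\<gamma>\<le>\<beta>. \<Sum>\<delta>\<le>\<gamma>. ?G \<alpha> \<beta> \<gamma> \<delta>)"
    by (simp only: sum.swap[of _ _ "{..l}"])
  finally show ?thesis .
qed

end

section \<open>The characteristic and the conclusion\<close>

lemma six_neq_0:
  assumes "CHAR('f::field) \<noteq> 2" and "CHAR('f) \<noteq> 3"
  shows "(6 :: 'f) \<noteq> 0"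
proof
  assume "(6 :: 'f) = 0"
  then have "(2 :: 'f) * 3 = 0"
    by simp
  then have "(2 :: 'f) = 0 \<or> (3 :: 'f) = 0"
    by (simp only: mult_eq_0_iff)
  then have "of_nat 2 = (0 :: 'f) \<or> of_nat 3 = (0 :: 'f)"
    by simp
  then have "CHAR('f) dvd 2 \<or> CHAR('f) dvd 3"
    by (simp only: of_nat_eq_0_iff_char_dvd)
  \<comment> \<open>A divisor of the prime 2 or 3 is 1 or that prime, and characteristic 1 is
    impossible in a field.\<close>
  moreover have "n = 1 \<or> n = p" if "n dvd p" "p = 2 \<or> p = 3" for n p :: nat
  proof -
    have "n \<le> p" "n \<noteq> 0"
      using that by (auto dest: dvd_imp_le intro!: Nat.gr0I)
    then have "n = 1 \<or> n = 2 \<or> n = 3"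
      using that by auto
    then show ?thesis
      using that by auto
  qed
  ultimately have "CHAR('f) = 1"
    using assms by blast
  then show False by simp
qed

theorem theorem4p9:
  fixes i j k l m p q r s t :: int
  assumes "CHAR('f::field) \<noteq> 2" and "CHAR('f) \<noteq> 3"
    and "i \<ge> 0" and "j \<ge> 0" and "k \<ge> 0" and "l \<ge> 0" and "m \<ge> 0"
    and "p \<ge> 0" and "q \<ge> 0" and "r \<ge> 0" and "s \<ge> 0" and "t \<ge> 0"
  shows "(UM_monom i j k l m :: 'f UM) * UM_monom p q r s t =
    (\<Sum>\<alpha>=0..l. \<Sum>\<beta>=0..i. \<Sum>\<gamma>=0..\<beta>. \<Sum>\<delta>=0..\<gamma>. \<Sum>\<epsilon>=0..j-\<alpha>-\<delta>. \<Sum>\<zeta>=0..j-\<alpha>-\<delta>-\<epsilon>.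
     \<Sum>\<eta>=0..l-\<alpha>-(\<gamma>-\<delta>). \<Sum>\<theta>=0..l-\<alpha>-(\<gamma>-\<delta>)-\<eta>. \<Sum>\<kappa>=0..\<eta>.
      ((- 1) powi (\<beta> + \<zeta> + l - \<alpha> - \<gamma> - \<eta>)
       * (of_nat (fact (nat \<alpha>) * fact (nat \<beta>) * fact (nat \<kappa>))
          / (2 powi (\<alpha> + \<gamma>) * 3 powi (j - \<epsilon> - \<zeta> + l - \<alpha> - \<eta> - \<theta>)))
       * of_nat (multinom \<alpha> [\<beta> - \<gamma>] * multinom i [\<beta>] * multinom j [\<alpha>, \<delta>, \<epsilon>, \<zeta>]
          * multinom (j - \<alpha> - \<epsilon> - \<zeta>) [\<kappa>] * multinom l [\<alpha>, \<gamma> - \<delta>, \<eta>, \<theta>] * multinom \<eta> [\<kappa>])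
       * of_int (falling p (j - \<beta> - \<epsilon> + l - \<alpha> - \<eta> - \<theta>) * falling q (l - \<alpha> - \<eta> - \<theta>)
          * falling r \<theta> * falling s (j - \<alpha> - \<epsilon> - \<zeta> - \<kappa>)))
      *\<^sub>U UM_monom (i + p - j + \<epsilon> - l + \<alpha> + \<eta> + \<theta>) (\<epsilon> + q - l + \<alpha> + \<eta> + \<theta>)
           (\<zeta> + k + r - \<theta>) (\<eta> + s + \<alpha> + \<epsilon> + \<zeta> - j)
           (j - \<alpha> - \<epsilon> - \<zeta> + l - \<eta> + m + t))"
proof -
  interpret inv6 "inverse 6 :: 'f"
    by unfold_locales (use six_neq_0[OF assms(1,2)] in simp)
  obtain i' j' k' l' m' p' q' r' s' t' where *: "i = int i'"
    "j = int j'"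
    "k = int k'"
    "l = int l'"
    "m = int m'"
    "p = int p'"
    "q = int q'"
    "r = int r'"
    "s = int s'"
    "t = int t'"
    using assms by (metis zero_le_imp_eq_int)
  \<comment> \<open>Only the four outer ranges become ranges of natural numbers; the inner ones stay
    integral, since bounds such as \<open>j - \<alpha> - \<delta>\<close> can be negative.\<close>
  show ?thesis
    unfolding * summand_def[symmetric] sum_int_nat
    by (rule mult_mon_summand[unfolded mon_def])
qed

end
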